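(* Let $a\in\mathbb Z^+$. Then: (i) For every $m\in\mathbb Z^+$, $$\sum_{k=0}^{3^am-1}q^k\begin{bmatrix}2k\\k\end{bmatrix}_q\equiv 0 \pmod{[3^a]_q^2}.$$ (ii) Moreover, $$\frac{1}{[3^a]_q^2}\sum_{k=0}^{3^a-1}q^k\begin{bmatrix}2k\\k\end{bmatrix}_q\equiv 2R(a,q)\pmod{\Phi_{3^a}(q)},$$ where $$R(a,q)=\sum_{\substack{1\le k\le 3^a-1\\ k\equiv 1 \ (\mathrm{mod}\ 3)}} q^{\frac{(k+2)(k-1)}{6}}\,\frac{(-1)^{k}}{[k]_q^2}\left(1+\left(\frac{k-1}{3}-\frac{3^{a-1}+1}{2}\right)(1-q^k)\right).$$
   Context: For $n\in\mathbb N$, $[n]_q=\frac{1-q^n}{1-q}=\sum_{0\le j<n}q^j$. For $n,k\in\mathbb N$ the $q$-binomial coefficient is $\begin{bmatrix}n\\k\end{bmatrix}_q=\frac{[n]_q[n-1]_q\cdots[n-k+1]_q}{[1]_q[2]_q\cdots[k]_q}$ if $0<k\le n$, equal to $1$ if $k=0$, and $0$ if $k>n$. $\Phi_d(q)$ denotes the $d$-th cyclotomic polynomial; in particular $\Phi_{3^a}(q)=\frac{q^{3^a}-1}{q^{3^{a-1}}-1}$ and $[3^a]_q=\prod_{j=1}^a\Phi_{3^j}(q)$. Congruence convention: for rational functions $A,B\in\mathbb Q(q)$ and a nonconstant polynomial $M\in\mathbb Z[q]$, $A\equiv B\pmod{M}$ means $A-B=M\cdot C$ for some rational function $C$ whose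 reduced denominator is coprime to $M$ in $\mathbb Q[q]$ (for polynomials with integer coefficients and monic $M$ this is divisibility of $A-B$ by $M$ in $\mathbb Z[q]$). In (ii), the left-hand side is a polynomial by (i), and the denominators $[k]_q$ in $R(a,q)$ are coprime to $\Phi_{3^a}(q)$. *)

theory Defs
  imports "HOL-Computational_Algebra.Polynomial" "HOL-Computational_Algebra.Fraction_Field"
begin

definition qpoly :: "rat poly" where "qpoly = [:0, 1:]"

definition qint :: "nat \<Rightarrow> rat poly" where
  "qint n = (\<Sum>j<n. qpoly ^ j)"

(* q-binomial: [n][n-1]...[n-k+1] / ([1][2]...[k]) for 0<k<=n, 1 for k=0, 0 for k>n.
   The quotient is exact (a polynomial), so polynomial division computes it. *)
definition qbinom :: "nat \<Rightarrow> nat \<Rightarrow> rat poly" where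
  "qbinom n k = (if k = 0 then 1 else if k > n then 0 else
      (\<Prod>i<k. qint (n - i)) div (\<Prod>i\<in>{1..k}. qint i))"

(* Phi_{3^a}(q) = (q^{3^a} - 1) / (q^{3^{a-1}} - 1), a >= 1 *)
definition Phi3 :: "nat \<Rightarrow> rat poly" where
  "Phi3 a = (qpoly ^ (3 ^ a) - 1) div (qpoly ^ (3 ^ (a - 1)) - 1)"

definition tf :: "rat poly \<Rightarrow> rat poly fract" where
  "tf p = Fract p 1"

definition qcong :: "rat poly fract \<Rightarrow> rat poly fract \<Rightarrow> rat poly \<Rightarrow> bool" where
  "qcong A B M \<longleftrightarrow> (\<exists>c d. d \<noteq> 0 \<and> coprime d M \<and> A - B = tf M * Fract c d)"

definition Ssum :: "nat \<Rightarrow> rat poly" where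
  "Ssum N = (\<Sum>k<N. qpoly ^ k * qbinom (2 * k) k)"

definition Rfun :: "nat \<Rightarrow> rat poly fract" where
  "Rfun a = (\<Sum>k\<in>{k. 1 \<le> k \<and> k \<le> 3 ^ a - 1 \<and> k mod 3 = 1}.
      tf (qpoly ^ ((k + 2) * (k - 1) div 6)) * (-1) ^ k / (tf (qint k)) ^ 2 *
      (1 + tf [: of_nat (k - 1) / 3 - (3 ^ (a - 1) + 1) / 2 :] * tf (1 - qpoly ^ k)))"

end

theory Submission
  imports Defs "HOL-Computational_Algebra.Field_as_Ring"
    "HOL-Computational_Algebra.Polynomial_Factorial" "HOL-Number_Theory.Cong"
begin

text \<open>
  Write \<open>[n, k]\<close> for the Gaussian binomial coefficient. The Pascal recurrences give, by telescoping
  in \<open>i\<close> and induction on \<open>N\<close>, the identity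
  \<open>(\<Sum>k<N. q^k [2k, k]) = (\<Sum>i. q^(3i(2i+1)) [2N, N+3i+1] - q^(3(2i+1)(i+1)) [2N, N+3i+2])\<close>.
  For \<open>n = 3^a\<close> and \<open>n dvd N\<close> only indices prime to \<open>3\<close> occur on the right, so every term is a
  multiple of \<open>e = 1 - q^n\<close> in the localization of the polynomials at \<open>\<Phi>\<^sub>n\<close>, where \<open>e\<close> and
  \<open>\<Phi>\<^sub>n\<close> are associated. Reflecting \<open>v \<mapsto> n - v\<close> in each block of \<open>n\<close> consecutive indices
  cancels the terms modulo \<open>e\<^sup>2\<close>. As the \<open>\<Phi>\<close> at different powers of \<open>3\<close> are coprime, this
  gives (i). For \<open>N = n\<close> the same pairing is carried out modulo \<open>e\<^sup>3\<close>: the harmonic sums in the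
  first-order terms of \<open>[2n, v]\<close> and \<open>[2n, n - v]\<close> cancel because
  \<open>1/(1 - q^w) + 1/(1 - q^(n-w))\<close> is \<open>1\<close> modulo \<open>e\<close>, and what is left is \<open>2 [n]\<^sup>2 R(a, q)\<close>.
\<close>

section \<open>Gaussian binomial coefficients\<close>

text \<open>The Pascal recurrence makes polynomiality automatic; \<open>qbinom_eq_qgauss\<close>
  identifies this with the quotient in \<open>qbinom\<close>.\<close>

fun qgauss :: "nat \<Rightarrow> nat \<Rightarrow> rat poly" where
  "qgauss n 0 = 1"
| "qgauss 0 (Suc k) = 0"
| "qgauss (Suc n) (Suc k) = qgauss n k + qpoly ^ Suc k * qgauss n (Suc k)"

lemma qint_mult: "(1 - qpoly) * qint n = 1 - qpoly ^ n"
  unfolding qint_def by (simp add: one_diff_power_eq)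

lemma qint_add: "qint (m + n) = qint m + qpoly ^ m * qint n"
  by (induction n) (simp_all add: qint_def power_add algebra_simps)

lemma degree_qpoly_power: "degree (qpoly ^ n) = n"
  by (simp add: qpoly_def degree_power_eq)

lemma qpoly_power_neq_1: "n > 0 \<Longrightarrow> qpoly ^ n \<noteq> 1"
  using degree_qpoly_power[of n] by auto

lemma qint_nonzero: "n > 0 \<Longrightarrow> qint n \<noteq> 0"
  using qint_mult[of n] qpoly_power_neq_1[of n] by auto

lemma qint_0 [simp]: "qint 0 = 0"
  by (simp add: qint_def)

lemma prod_Suc_diff:
  "(\<Prod>i<Suc k. qint (Suc n - i)) = qint (Suc n) * (\<Prod>i<k. qint (n - i))"
  by (subst prod.lessThan_Suc_shift) simp

text \<open>The induction step is \<open>qint_add\<close> at \<open>Suc k\<close> and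
  \<open>n - k\<close>; cross-multiplying keeps division out of it.\<close>

lemma qgauss_prod: "qgauss n k * (\<Prod>i\<in>{1..k}. qint i) = (\<Prod>i<k. qint (n - i))"
proof (induction n k rule: qgauss.induct)
  case (3 n k)
  let ?P = "\<Prod>i<k. qint (n - i)"
  have "qgauss (Suc n) (Suc k) * (\<Prod>i\<in>{1..Suc k}. qint i)
      = ?P * qint (Suc k) + qpoly ^ Suc k * (qgauss n (Suc k) * (\<Prod>i\<in>{1..Suc k}. qint i))"
    using 3(1) by (simp add: algebra_simps)
  also have "\<dots> = ?P * (qint (Suc k) + qpoly ^ Suc k * qint (n - k))"
    unfolding 3(2) by (simp add: algebra_simps)
  also have "\<dots> = ?P * qint (Suc n)"
  proof (cases "k \<le> n")
    case True
    then show ?thesis using qint_add[of "Suc k" "n - k"] by simp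
  next
    case False
    \<comment> \<open>For \<open>k > n\<close> the factor at \<open>i = n\<close> is
      \<open>qint 0\<close>.\<close>
    then have "?P = 0" by (intro prod_zero) (auto intro!: bexI[of _ n])
    then show ?thesis by simp
  qed
  finally show ?case unfolding prod_Suc_diff by (simp add: mult.commute)
qed (simp_all add: prod.lessThan_Suc_shift del: prod.lessThan_Suc)

lemma prod_qint_nonzero: "(\<Prod>i\<in>{1..k}. qint i) \<noteq> 0"
  using qint_nonzero by (auto simp: Suc_le_eq)

lemma qgauss_gt: "k > n \<Longrightarrow> qgauss n k = 0"
  by (induction n k rule: qgauss.induct) auto

lemma qbinom_eq_qgauss: "qbinom n k = qgauss n k"
proof -
  have "(\<Prod>i<k. qint (n - i)) div (\<Prod>i\<in>{1..k}. qint i) = qgauss n k"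
    using qgauss_prod[of n k] prod_qint_nonzero[of k]
    by (metis nonzero_mult_div_cancel_right)
  then show ?thesis by (simp add: qbinom_def qgauss_gt)
qed

lemma qbinom_gt: "k > n \<Longrightarrow> qbinom n k = 0"
  by (simp add: qbinom_def)

lemma qbinom_pascal:
  "qbinom (Suc n) (Suc k) = qbinom n k + qpoly ^ Suc k * qbinom n (Suc k)"
  by (simp add: qbinom_eq_qgauss)

lemma qbinom_absorb: "qint (Suc k) * qbinom n (Suc k) = qint (n - k) * qbinom n k"
proof -
  have "(qint (Suc k) * qgauss n (Suc k)) * (\<Prod>i\<in>{1..k}. qint i)
      = (qint (n - k) * qgauss n k) * (\<Prod>i\<in>{1..k}. qint i)"
    using qgauss_prod[of n "Suc k"] qgauss_prod[of n k]
    by (simp add: mult_ac)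
  then show ?thesis
    using prod_qint_nonzero[of k] by (simp add: qbinom_eq_qgauss)
qed

lemma qbinom_absorb':
  "(1 - qpoly ^ Suc k) * qbinom n (Suc k) = (1 - qpoly ^ (n - k)) * qbinom n k"
  unfolding qint_mult[symmetric] mult.assoc qbinom_absorb ..

text \<open>The two Pascal rules differ exactly by the absorption identity.\<close>

lemma qbinom_pascal':
  "qbinom (Suc n) (Suc k) = qpoly ^ (n - k) * qbinom n k + qbinom n (Suc k)"
  using qbinom_pascal[of n k] qbinom_absorb'[of k n] by (simp add: algebra_simps)

lemma qbinom_self: "qbinom n n = 1"
  by (induction n) (simp_all add: qbinom_pascal qbinom_gt, simp add: qbinom_def)

section \<open>An alternating sum for the partial sums of central coefficients\<close>

abbreviation qcentral :: "nat \<Rightarrow> nat \<Rightarrow> rat poly" where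
  "qcentral n j \<equiv> qbinom (2 * n) (n + j)"

lemma qcentral_gt: "j > n \<Longrightarrow> qcentral n j = 0"
  by (simp add: qbinom_gt)

text \<open>One Pascal rule leads from row \<open>2 * n + 2\<close> to \<open>2 * n + 1\<close>, the
  other from there to \<open>2 * n\<close>. This mix gives the middle coefficient
  \<open>1 + qpoly ^ (2 * n + 1)\<close>, whose summand 1 cancels the old row in
  \<open>qalt_telescope\<close>.\<close>

lemma qcentral_Suc:
  "qcentral (Suc n) (Suc j) = qpoly ^ (n - j) * qcentral n j
     + (1 + qpoly ^ (2 * n + 1)) * qcentral n (Suc j) + qpoly ^ (n + j + 2) * qcentral n (j + 2)"
proof -
  have 1: "qcentral (Suc n) (Suc j)
      = qbinom (Suc (2 * n)) (Suc (n + j)) + qpoly ^ (n + j + 2) * qbinom (Suc (2 * n)) (Suc (n + Suc j))"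
    using qbinom_pascal[of "Suc (2 * n)" "Suc (n + j)"] by simp
  have 2: "qbinom (Suc (2 * n)) (Suc (n + j)) = qpoly ^ (n - j) * qcentral n j + qcentral n (Suc j)"
    using qbinom_pascal'[of "2 * n" "n + j"] by simp
  have 3: "qbinom (Suc (2 * n)) (Suc (n + Suc j))
      = qpoly ^ (n - Suc j) * qcentral n (Suc j) + qcentral n (j + 2)"
    using qbinom_pascal'[of "2 * n" "n + Suc j"] by simp
  \<comment> \<open>The truncated \<open>n - Suc j\<close> is harmless: when
    \<open>Suc j > n\<close> the coefficient itself is zero.\<close>
  have 4: "qpoly ^ (n + j + 2) * (qpoly ^ (n - Suc j) * qcentral n (Suc j))
     = qpoly ^ (2 * n + 1) * qcentral n (Suc j)"
  proof (cases "Suc j \<le> n")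
    case True
    then have "n + j + 2 + (n - Suc j) = 2 * n + 1" by simp
    then show ?thesis by (simp only: mult.assoc[symmetric] flip: power_add)
  qed (use qcentral_gt[of n "Suc j"] in simp)
  show ?thesis unfolding 1 2 3 distrib_left 4 by (simp add: algebra_simps)
qed

abbreviation qalt :: "nat \<Rightarrow> nat \<Rightarrow> rat poly" where
  "qalt n i \<equiv> qpoly ^ (3 * i * (2 * i + 1)) * qcentral n (3 * i + 1)
    - qpoly ^ (3 * (2 * i + 1) * (i + 1)) * qcentral n (3 * i + 2)"

text \<open>The change in \<open>n\<close> is a difference in \<open>i\<close>. After expansion by
  \<open>qcentral_Suc\<close>, the terms in \<open>B 1\<close> and \<open>B 2\<close> share the
  factor \<open>qpoly ^ e\<close> and cancel by absorption; \<open>B 0\<close> and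
  \<open>B 3\<close> carry one sequence, taken at \<open>i\<close> and at
  \<open>Suc i\<close>.\<close>

lemma qalt_telescope:
  "qalt (Suc n) i - qalt n i
    = qpoly ^ (n + 6 * i\<^sup>2) * qcentral n (3 * i) - qpoly ^ (n + 6 * (Suc i)\<^sup>2) * qcentral n (3 * Suc i)"
proof -
  define e where "e = 6 * i\<^sup>2 + 6 * i + n + 2"
  define B where "B j = qcentral n (3 * i + j)" for j
  have B0: "3 * i + j > n \<Longrightarrow> B j = 0" for j
    unfolding B_def by (rule qcentral_gt)
  have shift: "qpoly ^ k * (qpoly ^ (n - (3 * i + j)) * B j) = qpoly ^ l * B j"
    if "k + n = l + (3 * i + j)" for k l j
  proof (cases "3 * i + j \<le> n")
    case True
    with that have "k + (n - (3 * i + j)) = l" by simp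
    then show ?thesis by (simp only: mult.assoc[symmetric] flip: power_add)
  qed (simp add: B0)
  have 1: "qcentral (Suc n) (3 * i + 1) = qpoly ^ (n - (3 * i + 0)) * B 0
     + (1 + qpoly ^ (2 * n + 1)) * B 1 + qpoly ^ (n + 3 * i + 2) * B 2"
    using qcentral_Suc[of n "3 * i"] by (simp add: B_def)
  have 2: "qcentral (Suc n) (3 * i + 2) = qpoly ^ (n - (3 * i + 1)) * B 1
     + (1 + qpoly ^ (2 * n + 1)) * B 2 + qpoly ^ (n + 3 * i + 3) * B 3"
    using qcentral_Suc[of n "3 * i + 1"] by (simp add: B_def numeral_eq_Suc)
  have 3: "qpoly ^ e * ((1 - qpoly ^ (n + 3 * i + 2)) * B 2)
      = qpoly ^ e * ((1 - qpoly ^ (n - (3 * i + 1))) * B 1)"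
    using qbinom_absorb'[of "n + 3 * i + 1" "2 * n"]
    by (simp add: B_def numeral_eq_Suc)
  have 4: "qpoly ^ (3 * i * (2 * i + 1)) * (qpoly ^ (n - (3 * i + 0)) * B 0) = qpoly ^ (n + 6 * i\<^sup>2) * B 0"
    by (rule shift) (simp add: power2_eq_square algebra_simps)
  have 5: "qpoly ^ (3 * (2 * i + 1) * (i + 1)) * (qpoly ^ (n - (3 * i + 1)) * B 1) = qpoly ^ e * B 1"
    by (rule shift) (simp add: e_def power2_eq_square algebra_simps)
  have 6: "qpoly ^ e * (qpoly ^ (n - (3 * i + 1)) * B 1)
      = qpoly ^ (3 * i * (2 * i + 1)) * (qpoly ^ (2 * n + 1) * B 1)"
    unfolding mult.assoc[of _ "qpoly ^ (2 * n + 1)", symmetric] power_add[symmetric]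
    by (rule shift) (simp add: e_def power2_eq_square algebra_simps)
  have merge: "qpoly ^ k * (qpoly ^ l * x) = qpoly ^ m * x" if "k + l = m" for k l m x
    unfolding that[symmetric] power_add by (rule mult.assoc[symmetric])
  have 7: "qpoly ^ (3 * i * (2 * i + 1)) * (qpoly ^ (n + 3 * i + 2) * B 2) = qpoly ^ e * B 2"
    by (rule merge) (simp add: e_def power2_eq_square algebra_simps)
  have 8: "qpoly ^ (3 * (2 * i + 1) * (i + 1)) * (qpoly ^ (2 * n + 1) * B 2)
      = qpoly ^ e * (qpoly ^ (n + 3 * i + 2) * B 2)"
    unfolding mult.assoc[of "qpoly ^ e", symmetric] power_add[symmetric]
    by (rule merge) (simp add: e_def power2_eq_square algebra_simps)
  have 9: "qpoly ^ (3 * (2 * i + 1) * (i + 1)) * (qpoly ^ (n + 3 * i + 3) * B 3)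
      = qpoly ^ (n + 6 * (Suc i)\<^sup>2) * B 3"
    by (rule merge) (simp add: power2_eq_square algebra_simps)
  have expand: "a * (x + (1 + p) * B 1 + y - B 1) - b * (u + (1 + p) * B 2 + v - B 2)
      = a * x + a * (p * B 1) + a * y - (b * u + b * (p * B 2) + b * v)" for a b p u v x y
    by (simp add: algebra_simps)
  have "qalt (Suc n) i - qalt n i
      = qpoly ^ (3 * i * (2 * i + 1)) * (qcentral (Suc n) (3 * i + 1) - B 1)
        - qpoly ^ (3 * (2 * i + 1) * (i + 1)) * (qcentral (Suc n) (3 * i + 2) - B 2)"
    unfolding B_def right_diff_distrib by simp
  also have "\<dots> = qpoly ^ (n + 6 * i\<^sup>2) * B 0 - qpoly ^ (n + 6 * (Suc i)\<^sup>2) * B 3"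
    unfolding 1 2 expand 4 5 7 8 9 6[symmetric]
    using 3 unfolding left_diff_distrib right_diff_distrib mult_1_left by (simp only: diff_eq_eq eq_diff_eq ac_simps)
  finally show ?thesis by (simp add: B_def add.commute)
qed

text \<open>The telescoped sequence at \<open>i = 0\<close> is the next summand of
  \<open>Ssum\<close>; at \<open>i = M\<close> it vanishes because \<open>3 * M > n\<close>. The
  bound \<open>M\<close> stays fixed during the induction.\<close>

lemma Ssum_eq: "n \<le> 3 * M \<Longrightarrow> Ssum n = (\<Sum>i<M. qalt n i)"
proof (induction n)
  case 0
  then show ?case by (simp add: Ssum_def qbinom_gt)
next
  case (Suc n)
  have "(\<Sum>i<M. qalt (Suc n) i) - (\<Sum>i<M. qalt n i)
      = (\<Sum>i<M. qpoly ^ (n + 6 * i\<^sup>2) * qcentral n (3 * i) - qpoly ^ (n + 6 * (Suc i)\<^sup>2) * qcentral n (3 * Suc i))"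
    unfolding sum_subtractf[symmetric] qalt_telescope ..
  also have "\<dots> = qpoly ^ n * qcentral n 0 - qpoly ^ (n + 6 * M\<^sup>2) * qcentral n (3 * M)"
    by (subst sum_lessThan_telescope') simp
  also have "qcentral n (3 * M) = 0"
    using Suc.prems by (intro qcentral_gt) simp
  finally show ?case using Suc by (simp add: Ssum_def algebra_simps)
qed

section \<open>Congruences modulo powers of an element\<close>

text \<open>\<open>R\<close> is a subring given as a set inside a field, so inverses can be written
  freely and only their membership in \<open>R\<close> has to be proved.\<close>

locale subring_elem =
  fixes R :: "'a::field set" and e :: 'a
  assumes one_closed [simp, intro]: "1 \<in> R"
    and diff_closed [simp, intro]: "\<And>x y. x \<in> R \<Longrightarrow> y \<in> R \<Longrightarrow> x - y \<in> R"
    and mult_closed [simp, intro]: "\<And>x y. x \<in> R \<Longrightarrow> y \<in> R \<Longrightarrow> x * y \<in> R"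
    and e_closed [simp, intro]: "e \<in> R"
begin

lemma zero_closed [simp, intro]: "0 \<in> R"
  using diff_closed[OF one_closed one_closed] by simp

lemma uminus_closed [simp, intro]: "x \<in> R \<Longrightarrow> - x \<in> R"
  using diff_closed[OF zero_closed] by simp

lemma add_closed [simp, intro]: "x \<in> R \<Longrightarrow> y \<in> R \<Longrightarrow> x + y \<in> R"
  using diff_closed[OF _ uminus_closed] by fastforce

lemma power_closed [simp, intro]: "x \<in> R \<Longrightarrow> x ^ k \<in> R"
  by (induction k) auto

lemma of_nat_closed [simp, intro]: "of_nat k \<in> R"
  by (induction k) auto

lemma of_int_closed [simp, intro]: "of_int k \<in> R"
  by (cases k rule: int_cases2) auto

lemma sum_closed [intro]: "(\<And>i. i \<in> A \<Longrightarrow> f i \<in> R) \<Longrightarrow> sum f A \<in> R"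
  by (induction A rule: infinite_finite_induct) auto

definition eqm :: "nat \<Rightarrow> 'a \<Rightarrow> 'a \<Rightarrow> bool" where
  "eqm j x y \<longleftrightarrow> (\<exists>z\<in>R. x - y = e ^ j * z)"

lemma eqmI: "z \<in> R \<Longrightarrow> x - y = e ^ j * z \<Longrightarrow> eqm j x y"
  unfolding eqm_def by blast

lemma eqm_refl [simp, intro]: "eqm j x x"
  by (rule eqmI[of 0]) auto

lemma eqm_sym: "eqm j x y \<Longrightarrow> eqm j y x"
  unfolding eqm_def by (metis minus_diff_eq mult_minus_right uminus_closed)

lemma eqm_add: "eqm j x y \<Longrightarrow> eqm j x' y' \<Longrightarrow> eqm j (x + x') (y + y')"
  unfolding eqm_def by (metis add_closed add_diff_add distrib_left)

lemma eqm_uminus: "eqm j x y \<Longrightarrow> eqm j (- x) (- y)"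
  unfolding eqm_def by (metis minus_diff_minus mult_minus_right uminus_closed)

lemma eqm_diff: "eqm j x y \<Longrightarrow> eqm j x' y' \<Longrightarrow> eqm j (x - x') (y - y')"
  using eqm_add[OF _ eqm_uminus, of j x y x' y'] by simp

lemma eqm_trans [trans]: "eqm j x y \<Longrightarrow> eqm j y z \<Longrightarrow> eqm j x z"
  using eqm_add[of j x y y z] by (auto simp: eqm_def)

lemma eqm_scale: "c \<in> R \<Longrightarrow> eqm j x y \<Longrightarrow> eqm j (c * x) (c * y)"
  unfolding eqm_def by (metis mult.left_commute mult_closed right_diff_distrib)

lemma eqm_mult:
  assumes "eqm j x y" "eqm j x' y'" "x \<in> R" "y' \<in> R"
  shows "eqm j (x * x') (y * y')"
proof -
  have "eqm j (x * x') (x * y')" using assms by (intro eqm_scale)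
  also have "eqm j (x * y') (y * y')"
    using eqm_scale[OF assms(4,1)] by (simp add: mult.commute)
  finally show ?thesis .
qed

text \<open>Precisions add: a factor divisible by \<open>e ^ i\<close> lifts a congruence from order
  \<open>j\<close> to order \<open>i + j\<close>. All second and third order results below arise in
  this way.\<close>

lemma eqm_scale_zero: "eqm i c 0 \<Longrightarrow> eqm j x y \<Longrightarrow> eqm (i + j) (c * x) (c * y)"
  unfolding eqm_def
  by (auto simp: power_add right_diff_distrib[symmetric])

lemma eqm_sum: "(\<And>i. i \<in> A \<Longrightarrow> eqm j (f i) (g i)) \<Longrightarrow> eqm j (sum f A) (sum g A)"
  by (induction A rule: infinite_finite_induct) (auto intro: eqm_add)

lemma eqm_inverse:
  assumes "eqm j x y" "inverse x \<in> R" "inverse y \<in> R" "x \<noteq> 0" "y \<noteq> 0"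
  shows "eqm j (inverse x) (inverse y)"
proof -
  have "eqm j (inverse x * inverse y * x) (inverse x * inverse y * y)"
    using assms by (intro eqm_scale) auto
  moreover have "inverse x * inverse y * x = inverse y" "inverse x * inverse y * y = inverse x"
    using assms by (simp_all add: field_simps)
  ultimately show ?thesis by (simp add: eqm_sym)
qed

lemma eqm_e_zero: "x \<in> R \<Longrightarrow> eqm 1 (e * x) 0"
  by (rule eqmI[of x]) auto

text \<open>\<open>unipot x a\<close> says that \<open>a\<close> is the logarithmic derivative of \<open>x\<close> with respect to \<open>e\<close>.\<close>

definition unipot :: "'a \<Rightarrow> 'a \<Rightarrow> bool" where
  "unipot x a \<longleftrightarrow> x \<in> R \<and> a \<in> R \<and> eqm 2 x (1 + e * a)"

lemma unipot_closed: "unipot x a \<Longrightarrow> x \<in> R" "unipot x a \<Longrightarrow> a \<in> R"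
  by (simp_all add: unipot_def)

lemma unipot_1: "unipot 1 0"
  by (simp add: unipot_def)

lemma unipot_mult:
  assumes "unipot x a" "unipot y b"
  shows "unipot (x * y) (a + b)"
proof -
  have "eqm 2 (x * y) ((1 + e * a) * (1 + e * b))"
    using assms by (intro eqm_mult) (auto simp: unipot_def)
  also have "eqm 2 \<dots> (1 + e * (a + b))"
    by (rule eqmI[of "a * b"]) (use assms in \<open>auto simp: unipot_def algebra_simps power2_eq_square\<close>)
  finally show ?thesis using assms by (auto simp: unipot_def)
qed

text \<open>The product \<open>x * (1 - e * a)\<close> is 1 up to a multiple of
  \<open>e\<^sup>2\<close>.\<close>

lemma unipot_inverse:
  assumes "unipot x a" "inverse x \<in> R" "x \<noteq> 0"
  shows "unipot (inverse x) (- a)"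
proof -
  have "eqm 2 (inverse x * (1 - x * (1 - e * a))) (inverse x * 0)"
  proof (intro eqm_scale assms)
    have "eqm 2 (1 - x * (1 - e * a)) (1 - (1 + e * a) * (1 - e * a))"
      using assms by (intro eqm_diff eqm_mult) (auto simp: unipot_def)
    also have "eqm 2 \<dots> 0"
      by (rule eqmI[of "a * a"]) (use assms in \<open>auto simp: unipot_def algebra_simps power2_eq_square\<close>)
    finally show "eqm 2 (1 - x * (1 - e * a)) 0" .
  qed
  moreover have "inverse x * (1 - x * (1 - e * a)) = inverse x - (1 - e * a)"
    using assms by (simp add: field_simps)
  ultimately have "eqm 2 (inverse x) (1 - e * a)"
    by (simp add: eqm_def)
  then show ?thesis using assms by (auto simp: unipot_def)
qed

text \<open>The logarithmic derivative enters only through \<open>e * a\<close>, so it matters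
  modulo \<open>e\<close> alone.\<close>

lemma unipot_cong:
  assumes "unipot x a" "eqm 1 a b" "b \<in> R"
  shows "unipot x b"
proof -
  obtain z where z: "z \<in> R" "a - b = e * z"
    using assms by (auto simp: eqm_def)
  have "eqm 2 (1 + e * a) (1 + e * b)"
    by (rule eqmI[OF z(1)]) (use z(2) in \<open>simp add: algebra_simps power2_eq_square\<close>)
  then show ?thesis using assms by (auto simp: unipot_def intro: eqm_trans)
qed

lemma unipot_diff:
  assumes "unipot x a" "unipot y b"
  shows "eqm 2 (x - y) (e * (a - b))"
  using eqm_diff[of 2 x "1 + e * a" y "1 + e * b"] assms
  by (simp add: unipot_def right_diff_distrib)

end

text \<open>Modulo \<open>e\<close>, \<open>q\<close> is an \<open>n\<close>-th root of unity,
  primitive in the strong sense that every \<open>1 - q ^ w\<close> with \<open>w\<close> not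
  divisible by \<open>n\<close> is a unit of \<open>R\<close>.\<close>

locale root_of_unity_expansion = subring_elem +
  fixes q :: 'a and n :: nat
  assumes e_def: "e = 1 - q ^ n"
    and n_gt_1: "n > 1"
    and q_nonzero [simp]: "q \<noteq> 0"
    and q_closed [simp, intro]: "q \<in> R"
    and inverse_q_closed [simp, intro]: "inverse q \<in> R"
    and cyclo_nonzero: "\<And>w. \<not> n dvd w \<Longrightarrow> 1 - q ^ w \<noteq> 0"
    and inverse_cyclo_closed: "\<And>w. \<not> n dvd w \<Longrightarrow> inverse (1 - q ^ w) \<in> R"
begin

lemma powi_closed [simp, intro]: "q powi k \<in> R"
  by (cases k rule: int_cases2) (auto simp: power_int_minus simp flip: power_inverse)

lemma q_pow_n: "q ^ n = 1 - e"
  by (simp add: e_def)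

lemma unipot_qn: "unipot (q ^ n) (- 1)"
  by (simp add: unipot_def q_pow_n del: One_nat_def)

text \<open>Since \<open>q ^ n = 1 - e\<close>, each factor contributes \<open>- 1\<close>; negative
  \<open>k\<close> follows by inversion.\<close>

lemma unipot_powi: "unipot (q powi (int n * k)) (- of_int k)"
proof -
  have pos: "unipot (q powi (int n * int k)) (- of_nat k)" for k
  proof (induction k)
    case (Suc k)
    show ?case using unipot_mult[OF Suc unipot_qn]
      by (simp add: power_int_add algebra_simps)
  qed (simp add: unipot_1)
  show ?thesis
  proof (cases k rule: int_cases2)
    case (nonneg m)
    then show ?thesis using pos by simp
  next
    case (nonpos m)
    then show ?thesis using unipot_inverse[OF pos[of m]]
      by (simp flip: power_int_minus)
  qed
qed

lemma eqm_powi_cong: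
  assumes "[x = y] (mod int n)"
  shows "eqm 1 (q powi x) (q powi y)"
proof -
  obtain k where k: "x = y + int n * k"
    using assms by (metis cong_iff_lin cong_sym)
  obtain z where z: "z \<in> R" "q powi (int n * k) - (1 + e * (- of_int k)) = e\<^sup>2 * z"
    using unipot_powi[of k] by (auto simp: unipot_def eqm_def)
  then have "eqm 1 (q powi (int n * k)) 1"
    by (intro eqmI[of "e * z - of_int k"]) (auto simp: algebra_simps power2_eq_square)
  then have "eqm 1 (q powi y * q powi (int n * k)) (q powi y * 1)"
    by (intro eqm_scale) auto
  then show ?thesis by (simp add: k power_int_add)
qed

lemma eqm_power_cong: "[x = y] (mod n) \<Longrightarrow> eqm 1 (q ^ x) (q ^ y)"
  using eqm_powi_cong[of "int x" "int y"] by (simp add: cong_int_iff)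

lemma not_dvd_less: "0 < w \<Longrightarrow> w < n \<Longrightarrow> \<not> n dvd w"
  by (auto dest: dvd_imp_le)

lemma not_dvd_add: "0 < w \<Longrightarrow> w < n \<Longrightarrow> \<not> n dvd (n * u + w)"
  by (simp add: dvd_add_right_iff not_dvd_less)

section \<open>Leading coefficients of Gaussian binomials in a block of \<open>n\<close>
  indices\<close>

definition tri :: "nat \<Rightarrow> int" where
  "tri v = int v * (int v - 1) div 2"

text \<open>This is \<open>- 1 / (1 - q ^ v)\<close> times the product of
  \<open>(1 - q powi (- w)) / (1 - q ^ w)\<close> over \<open>0 < w < v\<close>, evaluated in closed
  form.\<close>

definition res :: "nat \<Rightarrow> 'a" where
  "res v = (- 1) ^ v * q powi (- tri v) / (1 - q ^ v)"

lemma tri_double: "2 * tri v = int v * (int v - 1)"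
  unfolding tri_def by simp

lemma tri_Suc: "tri (Suc v) = tri v + int v"
  using tri_double[of v] tri_double[of "Suc v"] by (simp add: algebra_simps)

lemma res_closed: "0 < v \<Longrightarrow> v < n \<Longrightarrow> res v \<in> R"
  unfolding res_def divide_inverse
  by (intro mult_closed inverse_cyclo_closed not_dvd_less) auto

lemma res_Suc:
  assumes "0 < v" "Suc v < n"
  shows "res (Suc v) = res v * (- (q powi (- int v))) * ((1 - q ^ v) / (1 - q ^ Suc v))"
proof -
  have "q powi (- tri (Suc v)) = q powi (- tri v) * q powi (- int v)"
    by (simp add: tri_Suc flip: power_int_add)
  then show ?thesis using cyclo_nonzero[OF not_dvd_less[of v]] assms by (simp add: res_def)
qed

lemma eqm_cyclo_sub:
  assumes "v \<le> n * k" 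
  shows "eqm 1 (1 - q ^ (n * k - v)) (- (q powi (- int v)) * (1 - q ^ v))"
proof -
  have "eqm 1 (q powi (int (n * k - v))) (q powi (- int v))"
    using assms by (intro eqm_powi_cong) (simp add: cong_iff_dvd_diff of_nat_diff)
  then have "eqm 1 (1 - q powi (int (n * k - v))) (1 - q powi (- int v))"
    by (intro eqm_diff) auto
  then show ?thesis by (simp add: right_diff_distrib power_int_minus)
qed

text \<open>\<open>B j\<close> stands for the binomial of row \<open>2 * n * m\<close> at
  \<open>n * m + j\<close>, and \<open>rec\<close> is absorption. The step from \<open>n * u\<close>
  to \<open>n * u + 1\<close> brings the factor \<open>1 - q ^ (n * (m - u))\<close>, divisible by
  \<open>e\<close>. Inside the block, consecutive ratios agree modulo \<open>e\<close> with those of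
  \<open>res\<close>.\<close>

lemma block_values:
  assumes rec: "\<And>j. j < n * m \<Longrightarrow> (1 - q ^ (n * m + j + 1)) * B (j + 1) = (1 - q ^ (n * m - j)) * B j"
    and B: "\<And>j. B j \<in> R" and u: "u < m"
  obtains K where "K \<in> R" "eqm 1 K 0"
    "\<And>v. 0 < v \<Longrightarrow> v < n \<Longrightarrow> eqm 2 (B (n * u + v)) (K * res v)"
proof -
  let ?b = "B (n * u + 1)"
  have shift: "n * m + (n * u + w) = n * (m + u) + w" "n * m - (n * u + w) = n * (m - u) - w" for w
    by (simp_all add: algebra_simps diff_mult_distrib2)
  have bound: "n * u + v < n * m" if "v < n" for v
  proof -
    have "n * u + v < n * Suc u" using that by simp
    also have "\<dots> \<le> n * m" using u by (intro mult_le_mono) auto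
    finally show ?thesis .
  qed
  have rec': "B (n * u + Suc w) = (1 - q ^ (n * (m - u) - w)) * inverse (1 - q ^ (n * (m + u) + Suc w)) * B (n * u + w)"
    if "Suc w < n" for w
    using rec[OF bound[of w]] shift(1)[of "Suc w"] shift(2)[of w] that
      cyclo_nonzero[OF not_dvd_add[of "Suc w" "m + u"]]
    by (simp add: field_simps)
  have mu: "n \<le> n * (m - u)" using u by (cases "m - u") auto
  have b0: "eqm 1 ?b 0"
  proof -
    have "eqm 1 (1 - q ^ (n * (m - u))) (1 - 1)"
      using eqm_power_cong[of "n * (m - u)" 0] by (intro eqm_diff) (auto simp: cong_0_iff)
    then have "eqm 1 (inverse (1 - q ^ (n * (m + u) + 1)) * B (n * u) * (1 - q ^ (n * (m - u))))
        (inverse (1 - q ^ (n * (m + u) + 1)) * B (n * u) * 0)"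
      using n_gt_1 by (intro eqm_scale mult_closed B inverse_cyclo_closed not_dvd_add) auto
    then show ?thesis using rec'[of 0] n_gt_1 by (simp add: mult_ac)
  qed
  \<comment> \<open>\<open>P\<close> is the quotient by the first entry of the block; the constant
    \<open>- (1 - q)\<close> normalizes \<open>res 1\<close> to 1.\<close>
  have P: "\<exists>P\<in>R. B (n * u + v) = ?b * P \<and> eqm 1 P (- (1 - q) * res v)" if "0 < v" "v < n" for v
    using that
  proof (induction v rule: nat_induct_non_zero)
    case 1
    have "- (1 - q) * res 1 = 1"
      using cyclo_nonzero[of 1] n_gt_1 by (simp add: res_def tri_def field_simps)
    then show ?case by (intro bexI[of _ 1]) auto
  next
    case (Suc v)
    then obtain P where P: "P \<in> R" "B (n * u + v) = ?b * P" "eqm 1 P (- (1 - q) * res v)"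
      by auto
    let ?c = "1 - q ^ (n * (m - u) - v)" and ?d = "inverse (1 - q ^ (n * (m + u) + Suc v))"
    have d: "?d \<in> R" "inverse (1 - q ^ Suc v) \<in> R"
      using Suc.prems by (intro inverse_cyclo_closed not_dvd_add not_dvd_less; simp)+
    have "eqm 1 (P * ?c * ?d)
       ((- (1 - q) * res v) * (- (q powi (- int v)) * (1 - q ^ v)) * inverse (1 - q ^ Suc v))"
    proof (intro eqm_mult P(3) eqm_cyclo_sub eqm_inverse)
      show "v \<le> n * (m - u)" using mu Suc.prems by linarith
      show "eqm 1 (1 - q ^ (n * (m + u) + Suc v)) (1 - q ^ Suc v)"
        by (intro eqm_diff eqm_refl eqm_power_cong) (simp add: cong_def)
      show "1 - q ^ (n * (m + u) + Suc v) \<noteq> 0" "1 - q ^ Suc v \<noteq> 0"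
        using Suc.prems by (intro cyclo_nonzero not_dvd_add not_dvd_less; simp)+
    qed (use P d Suc.prems in auto)
    then show ?case using rec'[of v] Suc.prems P d
      by (intro bexI[of _ "P * ?c * ?d"]) (auto simp: res_Suc[OF Suc.hyps Suc.prems] mult_ac divide_inverse)
  qed
  show thesis
  proof (rule that[of "- (1 - q) * ?b"])
    show "- (1 - q) * ?b \<in> R" using B by simp
    show "eqm 1 (- (1 - q) * ?b) 0" using eqm_scale[OF _ b0, of "- (1 - q)"] by simp
    fix v assume v: "0 < v" "v < n"
    from P[OF v] obtain p where p: "B (n * u + v) = ?b * p" "eqm 1 p (- (1 - q) * res v)" by blast
    have *: "?b * (- (1 - q) * res v) = - (1 - q) * ?b * res v" by (simp add: mult_ac)
    then show "eqm 2 (B (n * u + v)) (- (1 - q) * ?b * res v)"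
      using eqm_scale_zero[OF b0 p(2)] unfolding * p(1) one_add_one by simp
  qed
qed


text \<open>The exponents \<open>expo1 i\<close> and \<open>expo2 i\<close> are three times the triangular numbers of index
  \<open>2 * i\<close> and \<open>2 * i + 1\<close>.\<close>

definition expo1 :: "nat \<Rightarrow> nat" where "expo1 i = 3 * i * (2 * i + 1)"
definition expo2 :: "nat \<Rightarrow> nat" where "expo2 i = 3 * (2 * i + 1) * (i + 1)"

section \<open>Reflection \<open>v \<mapsto> n - v\<close> and cancellation modulo
  \<open>e\<^sup>2\<close>\<close>

lemma eqm_inverse_reflect:
  assumes "0 < v" "v < n"
  shows "eqm 1 (inverse (1 - q ^ (n - v))) (- (q ^ v) * inverse (1 - q ^ v))"
proof -
  have nz: "1 - q ^ (n - v) \<noteq> 0" "1 - q ^ v \<noteq> 0"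
    and cl: "inverse (1 - q ^ (n - v)) \<in> R" "inverse (1 - q ^ v) \<in> R"
    using assms by (intro cyclo_nonzero inverse_cyclo_closed not_dvd_less; simp)+
  have eq: "inverse (- (q powi (- int v)) * (1 - q ^ v)) = - (q ^ v) * inverse (1 - q ^ v)"
    by (simp add: power_int_minus)
  have "eqm 1 (inverse (1 - q ^ (n - v))) (inverse (- (q powi (- int v)) * (1 - q ^ v)))"
  proof (rule eqm_inverse)
    show "eqm 1 (1 - q ^ (n - v)) (- (q powi (- int v)) * (1 - q ^ v))"
      using eqm_cyclo_sub[of v 1] assms by simp
    show "inverse (- (q powi (- int v)) * (1 - q ^ v)) \<in> R"
      unfolding eq using cl by simp
  qed (use nz cl in auto)
  then show ?thesis unfolding eq .
qed

text \<open>The integer \<open>h\<close> is \<open>(n - 2 * v - 1) / 2\<close>, which exists for odd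
  \<open>n\<close>; it is kept explicit because its value enters at third order.\<close>

lemma tri_reflect:
  assumes "v < n" "2 * h = int n - 2 * int v - 1"
  shows "tri (n - v) = int n * h + tri v + int v"
proof -
  have "2 * tri (n - v) = 2 * (int n * h + tri v + int v)"
    using assms tri_double[of "n - v"] tri_double[of v]
    by (simp add: of_nat_diff distrib_left mult.left_commute[of 2 "int n"]) (simp add: algebra_simps)
  then show ?thesis by simp
qed

lemma neg_one_reflect: "odd n \<Longrightarrow> v < n \<Longrightarrow> (- 1) ^ (n - v) = - ((- 1) ^ v :: 'a)"
  by (cases "even v") (auto simp: uminus_power_if)

text \<open>Modulo \<open>3 * l\<close> the two exponents agree; the exact quotient is recorded for
  the expansion modulo \<open>e ^ 3\<close>.\<close>

lemma expo_reflect: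
  assumes "i < l"
  shows "int (expo2 (l - Suc i)) = int (expo1 i) + int (3 * l) * (2 * int l - 4 * int i - 1)"
proof -
  obtain k where "l = Suc i + k" using assms by (metis less_iff_Suc_add add_Suc)
  then show ?thesis by (simp add: expo1_def expo2_def algebra_simps)
qed

lemma expo1_shift: "[int (expo1 (l * u + i)) = int (expo1 i)] (mod int (3 * l))"
proof -
  have "int (expo1 (l * u + i)) = int (expo1 i)
      + int (3 * l) * (int u * (2 * int l * int u + 2 * int i + 1) + 2 * int i * int u)"
    by (simp add: expo1_def algebra_simps)
  then show ?thesis by (simp add: cong_def)
qed

lemma expo2_shift: "[int (expo2 (l * u + i)) = int (expo2 i)] (mod int (3 * l))"
proof -
  have "int (expo2 (l * u + i)) = int (expo2 i)
      + int (3 * l) * (2 * int u * (int l * int u + int i + 1) + (2 * int i + 1) * int u)"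
    by (simp add: expo2_def algebra_simps)
  then show ?thesis by (simp add: cong_def)
qed

lemma obtain_half:
  assumes "odd n"
  obtains h where "2 * h = int n - 2 * int v - 1"
proof -
  have "even (int n - 2 * int v - 1)" using assms by simp
  then show thesis using that by (metis dvdE)
qed

text \<open>Because \<open>3 * (l - Suc i) + 2 = n - v\<close>, the two terms are mirror images. The
  sign from odd \<open>n\<close> meets the sign in \<open>eqm_inverse_reflect\<close>, and the
  factor \<open>q ^ v\<close> there absorbs the extra \<open>int v\<close> in
  \<open>tri_reflect\<close>.\<close>

lemma residues_cancel:
  assumes n3: "n = 3 * l" and odd: "odd n" and i: "i < l"
  shows "eqm 1 (q ^ expo1 (l * u + i) * res (3 * i + 1))
    (q ^ expo2 (l * u + (l - Suc i)) * res (3 * (l - Suc i) + 2))"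
proof -
  define v where "v = 3 * i + 1"
  define k where "k = l - Suc i"
  have v: "0 < v" "v < n" using i n3 by (auto simp: v_def)
  have nv: "3 * k + 2 = n - v" using i n3 by (auto simp: v_def k_def)
  obtain h where h: "2 * h = int n - 2 * int v - 1" using obtain_half[OF odd] .
  let ?E = "int (expo1 (l * u + i))" and ?F = "int (expo2 (l * u + k))"
  have c: "[?F - tri (n - v) = ?E - tri v - int v] (mod int n)"
  proof -
    have "[?F = int (expo2 k)] (mod int n)" "[int (expo1 i) = ?E] (mod int n)"
      unfolding n3 by (rule expo2_shift cong_sym[OF expo1_shift])+
    moreover have "[int (expo2 k) = int (expo1 i)] (mod int n)"
      using expo_reflect[OF i] unfolding k_def n3 by (simp add: cong_def)
    ultimately have "[?F = ?E] (mod int n)" by (metis cong_trans)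
    moreover have "[tri (n - v) = tri v + int v] (mod int n)"
      unfolding tri_reflect[OF v(2) h] by (simp add: cong_def add.assoc)
    ultimately show ?thesis using cong_diff by (fastforce simp: diff_diff_eq)
  qed
  have "q ^ expo2 (l * u + k) * res (n - v)
      = - ((- 1) ^ v) * q powi (?F - tri (n - v)) * inverse (1 - q ^ (n - v))"
    using neg_one_reflect[OF odd v(2)]
    by (simp add: res_def power_int_diff power_int_minus divide_inverse)
  also have "eqm 1 \<dots> (- ((- 1) ^ v) * q powi (?E - tri v - int v) * (- (q ^ v) * inverse (1 - q ^ v)))"
    using v by (intro eqm_mult eqm_scale eqm_powi_cong[OF c] eqm_inverse_reflect mult_closed
        uminus_closed inverse_cyclo_closed not_dvd_less) auto
  also have "\<dots> = q ^ expo1 (l * u + i) * res v"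
    by (simp add: res_def power_int_diff power_int_minus divide_inverse)
  finally show ?thesis
    unfolding v_def[symmetric] k_def[symmetric] nv by (rule eqm_sym)
qed

text \<open>Two factors \<open>e\<close> combine in each block: one is in the common constant
  \<open>K\<close>, the other comes from the cancellation of the residues.\<close>

theorem alternating_sum_eqm_2:
  assumes rec: "\<And>j. j < n * m \<Longrightarrow> (1 - q ^ (n * m + j + 1)) * B (j + 1) = (1 - q ^ (n * m - j)) * B j"
    and B: "\<And>j. B j \<in> R"
    and n3: "n = 3 * l" and odd: "odd n"
  shows "eqm 2 (\<Sum>i<l * m. q ^ expo1 i * B (3 * i + 1) - q ^ expo2 i * B (3 * i + 2)) 0"
proof -
  have block: "eqm 2 (\<Sum>i<l. q ^ expo1 (l * u + i) * B (3 * (l * u + i) + 1)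
      - q ^ expo2 (l * u + i) * B (3 * (l * u + i) + 2)) 0" if u: "u < m" for u
  proof -
    obtain K where K: "K \<in> R" "eqm 1 K 0"
      and val: "\<And>v. 0 < v \<Longrightarrow> v < n \<Longrightarrow> eqm 2 (B (n * u + v)) (K * res v)"
      using block_values[OF rec B u] by blast
    have arg: "3 * (l * u + i) + w = n * u + (3 * i + w)" for i w
      by (simp add: n3 algebra_simps)
    let ?f = "\<lambda>i. q ^ expo1 (l * u + i) * B (n * u + (3 * i + 1))"
    let ?g = "\<lambda>i. q ^ expo2 (l * u + i) * B (n * u + (3 * i + 2))"
    \<comment> \<open>Reversing the second sum puts each term next to its mirror image.\<close>
    have "(\<Sum>i<l. q ^ expo1 (l * u + i) * B (3 * (l * u + i) + 1)
      - q ^ expo2 (l * u + i) * B (3 * (l * u + i) + 2)) = (\<Sum>i<l. ?f i - ?g (l - Suc i))"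
      unfolding arg sum_subtractf sum.nat_diff_reindex[of ?g l] ..
    also have "eqm 2 \<dots> (\<Sum>i<l. 0)"
    proof (rule eqm_sum)
      fix i assume "i \<in> {..<l}"
      then have i: "i < l" by simp
      define k where "k = l - Suc i"
      have bd: "3 * i + 1 < n" "3 * k + 2 < n" using i n3 by (auto simp: k_def)
      have "eqm 2 (?f i - ?g k) (q ^ expo1 (l * u + i) * (K * res (3 * i + 1))
          - q ^ expo2 (l * u + k) * (K * res (3 * k + 2)))"
        using bd by (intro eqm_diff eqm_scale val) auto
      also have "\<dots> = K * (q ^ expo1 (l * u + i) * res (3 * i + 1))
          - K * (q ^ expo2 (l * u + k) * res (3 * k + 2))"
        by (simp add: mult.left_commute)
      also have "eqm 2 \<dots> 0"
        using eqm_scale_zero[OF K(2) residues_cancel[OF n3 odd i, of u]]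
        by (simp add: eqm_def k_def numeral_2_eq_2)
      finally show "eqm 2 (?f i - ?g (l - Suc i)) 0" by (simp add: k_def)
    qed
    finally show ?thesis by simp
  qed
  let ?t = "\<lambda>i. q ^ expo1 i * B (3 * i + 1) - q ^ expo2 i * B (3 * i + 2)"
  have "sum ?t {..<l * m} = (\<Sum>u<m. sum ?t {u * l..<u * l + l})"
    by (subst sum.nat_group) (simp add: mult.commute)
  also have "\<dots> = (\<Sum>u<m. \<Sum>i<l. ?t (l * u + i))"
  proof (rule sum.cong[OF refl])
    fix u
    show "sum ?t {u * l..<u * l + l} = (\<Sum>i<l. ?t (l * u + i))"
      using sum.shift_bounds_nat_ivl[of ?t 0 "u * l" l]
      by (simp add: lessThan_atLeast0 add.commute mult.commute)
  qed
  also have "eqm 2 \<dots> (\<Sum>u<m. 0)"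
    by (intro eqm_sum block) simp
  finally show ?thesis by simp
qed

section \<open>Harmonic sums and the expansion modulo \<open>e ^ 3\<close>\<close>

definition harm_q :: "nat \<Rightarrow> 'a" where
  "harm_q v = (\<Sum>w\<in>{1..v}. inverse (1 - q ^ w))"

lemma harm_q_Suc: "harm_q (Suc v) = harm_q v + inverse (1 - q ^ Suc v)"
  by (simp add: harm_q_def)

text \<open>The terms removed from \<open>harm_q (n - 1)\<close> are the inverses at
  \<open>n - w\<close> for \<open>1 \<le> w \<le> v\<close>, and each is
  \<open>1 - inverse (1 - q ^ w)\<close> modulo \<open>e\<close>.\<close>

lemma harm_q_reflect_aux:
  "v < n \<Longrightarrow> eqm 1 (harm_q (n - Suc v)) (harm_q (n - 1) + harm_q v - of_nat v)"
proof (induction v)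
  case 0
  then show ?case by (simp add: harm_q_def)
next
  case (Suc v)
  define w where "w = Suc v"
  have w: "0 < w" "w < n" using Suc.prems by (auto simp: w_def)
  have "harm_q (n - w) = harm_q (n - Suc w) + inverse (1 - q ^ (n - w))"
    using harm_q_Suc[of "n - Suc w"] unfolding Suc_diff_Suc[OF w(2)] by simp
  then have "harm_q (n - Suc w) = harm_q (n - Suc v) - inverse (1 - q ^ (n - w))"
    by (simp add: w_def)
  also have "eqm 1 \<dots> (harm_q (n - 1) + harm_q v - of_nat v - - (q ^ w) * inverse (1 - q ^ w))"
    using Suc w by (intro eqm_diff eqm_inverse_reflect) auto
  also have "\<dots> = harm_q (n - 1) + harm_q w - of_nat w"
  proof -
    have *: "q ^ w * inverse (1 - q ^ w) = inverse (1 - q ^ w) - 1"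
      using cyclo_nonzero[OF not_dvd_less[OF w]] by (simp add: field_simps)
    show ?thesis unfolding mult_minus_left * by (simp add: w_def harm_q_Suc)
  qed
  finally show ?case by (simp only: w_def)
qed

text \<open>The case \<open>v = n - 1\<close> of the previous congruence evaluates \<open>2 * harm_q (n - 1)\<close>.\<close>

lemma harm_q_reflect:
  assumes "v < n"
  shows "eqm 1 (2 * harm_q (n - Suc v)) (of_nat (n - 1) + 2 * harm_q v - 2 * of_nat v)"
proof -
  have two: "2 \<in> R" using of_nat_closed[of 2] by simp
  have "eqm 1 (harm_q 0) (2 * harm_q (n - 1) - of_nat (n - 1))"
    using harm_q_reflect_aux[of "n - 1"] n_gt_1 by simp
  from eqm_add[OF eqm_sym[OF this] eqm_refl[of 1 "of_nat (n - 1)"]]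
  have *: "eqm 1 (2 * harm_q (n - 1)) (of_nat (n - 1))"
    by (simp add: harm_q_def)
  have "eqm 1 (2 * harm_q (n - Suc v)) (2 * (harm_q (n - 1) + harm_q v - of_nat v))"
    by (intro eqm_scale harm_q_reflect_aux assms two)
  also have "\<dots> = 2 * harm_q (n - 1) + (2 * harm_q v - 2 * of_nat v)"
    by (simp add: algebra_simps)
  also have "eqm 1 \<dots> (of_nat (n - 1) + (2 * harm_q v - 2 * of_nat v))"
    by (intro eqm_add * eqm_refl)
  finally show ?thesis by (simp add: add_diff_eq)
qed

text \<open>Keeping the factor \<open>1 - q ^ (2 * n)\<close> exact, itself a multiple of
  \<open>e\<close>, means that first-order knowledge of \<open>x\<close> determines
  \<open>D v\<close> modulo \<open>e ^ 3\<close>.\<close>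

lemma row_values:
  assumes D0: "D 0 = 1"
    and rec: "\<And>v. v < n \<Longrightarrow> (1 - q ^ Suc v) * D (Suc v) = (1 - q ^ (2 * n - v)) * D v"
    and v: "0 < v" "v < n"
  shows "\<exists>x. D v = - (1 - q ^ (2 * n)) * res v * x \<and> unipot x (- 2 * harm_q (v - 1))"
  using v
proof (induction v rule: nat_induct_non_zero)
  case 1
  have "1 - q \<noteq> 0" using cyclo_nonzero[of 1] n_gt_1 by simp
  then have "D 1 = - (1 - q ^ (2 * n)) * res 1 * 1"
    using rec[of 0] n_gt_1 by (simp add: D0 res_def tri_def field_simps)
  moreover have "unipot 1 (- 2 * harm_q (1 - 1))"
    using unipot_1 by (simp add: harm_q_def)
  ultimately show ?case by blast
next
  case (Suc v)
  then obtain x where x: "D v = - (1 - q ^ (2 * n)) * res v * x" "unipot x (- 2 * harm_q (v - 1))"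
    by auto
  have nz: "1 - q ^ v \<noteq> 0" "1 - q ^ Suc v \<noteq> 0"
    using Suc by (intro cyclo_nonzero not_dvd_less; simp)+
  have cl: "inverse (1 - q ^ v) \<in> R"
    using Suc by (intro inverse_cyclo_closed not_dvd_less) auto
  have two: "2 \<in> R" using of_nat_closed[of 2] by simp
  \<comment> \<open>\<open>y\<close> is the exact correction in
    \<open>1 - q ^ (2 * n - v) = - (q powi (- int v)) * (1 - q ^ v) * y\<close>.\<close>
  define y where "y = 1 - (1 - q ^ (2 * n)) * inverse (1 - q ^ v)"
  have q2n: "q ^ (2 * n) = (1 - e)\<^sup>2"
    by (simp add: e_def power2_eq_square mult_2 power_add)
  have y: "unipot y (- 2 * inverse (1 - q ^ v))"
    unfolding unipot_def y_def q2n
  proof (intro conjI)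
    show "eqm 2 (1 - (1 - (1 - e)\<^sup>2) * inverse (1 - q ^ v)) (1 + e * (- 2 * inverse (1 - q ^ v)))"
      by (rule eqmI[OF cl]) (simp add: algebra_simps power2_eq_square)
  qed (use cl two in auto)
  have "q ^ (2 * n) = q ^ v * q ^ (2 * n - v)"
    using Suc by (simp flip: power_add)
  then have "1 - q ^ (2 * n - v) = - (q powi (- int v)) * (1 - q ^ v) * y"
    using nz by (simp add: y_def power_int_minus field_simps)
  then have "(1 - q ^ Suc v) * D (Suc v) = - (q powi (- int v)) * (1 - q ^ v) * y * D v"
    using rec[of v] Suc.prems by simp
  then have "D (Suc v) = - (q powi (- int v)) * (1 - q ^ v) * y * D v / (1 - q ^ Suc v)"
    using nz(2) by (metis nonzero_mult_div_cancel_left)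
  also have "\<dots> = - (1 - q ^ (2 * n)) * res (Suc v) * (x * y)"
    unfolding x(1) res_Suc[OF Suc.hyps Suc.prems] by simp
  finally have "D (Suc v) = - (1 - q ^ (2 * n)) * res (Suc v) * (x * y)" .
  moreover have "unipot (x * y) (- 2 * harm_q (Suc v - 1))"
    using unipot_mult[OF x(2) y] harm_q_Suc[of "v - 1"] Suc.hyps by (simp add: distrib_left add.commute)
  ultimately show ?case by blast
qed

text \<open>Both mirror terms are \<open>- (1 - q ^ (2 * n)) * c\<close> times a unipotent factor,
  \<open>X\<close> or \<open>Y\<close>. The prefactor is \<open>- 2 * e * c\<close> to first order
  and the logarithmic derivatives differ by \<open>- g\<close>, which gives
  \<open>2 * e\<^sup>2 * c * g\<close>.\<close>

lemma pair_eqm_3: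
  assumes D0: "D 0 = 1"
    and rec: "\<And>v. v < n \<Longrightarrow> (1 - q ^ Suc v) * D (Suc v) = (1 - q ^ (2 * n - v)) * D v"
    and n3: "n = 3 * l" and odd: "odd n" and i: "i < l" and v_def: "v = 3 * i + 1"
  shows "eqm 3 (q ^ expo1 i * D (n - v) - q ^ expo2 (l - Suc i) * D v)
    (2 * e\<^sup>2 * (q ^ expo1 i * res v * (inverse (1 - q ^ v) + of_int (int i - (int l + 1) div 2))))"
proof -
  define c where "c = q ^ expo1 i * res v"
  define r where "r = inverse (1 - q ^ v)"
  define g where "g = r + of_int (int i - (int l + 1) div 2)"
  define a where "a = 2 * int l - 4 * int i - 1"
  have v: "0 < v" "v < n" and v': "0 < n - v" "n - v < n" using i n3 by (auto simp: v_def)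
  obtain h where h: "2 * h = int n - 2 * int v - 1" using obtain_half[OF odd] .
  have two: "2 \<in> R" using of_nat_closed[of 2] by simp
  have nz: "1 - q ^ v \<noteq> 0" "1 - q ^ (n - v) \<noteq> 0"
    using v by (intro cyclo_nonzero not_dvd_less; simp)+
  have r: "r \<in> R" "inverse (1 - q ^ (n - v)) \<in> R"
    unfolding r_def using v by (intro inverse_cyclo_closed not_dvd_less; simp)+
  have c: "c \<in> R" unfolding c_def using res_closed[OF v] by auto
  have g: "g \<in> R" unfolding g_def using r by auto
  obtain x where x: "D v = - (1 - q ^ (2 * n)) * res v * x" "unipot x (- 2 * harm_q (v - 1))"
    using row_values[OF D0 rec v] by blast
  obtain x' where x': "D (n - v) = - (1 - q ^ (2 * n)) * res (n - v) * x'"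
      "unipot x' (- 2 * harm_q (n - v - 1))"
    using row_values[OF D0 rec v'] by blast
  \<comment> \<open>A sharpening of \<open>eqm_inverse_reflect\<close>: the inverse of
    \<open>y\<close> is exactly \<open>1 - e * r\<close>.\<close>
  define y where "y = - (1 - q ^ v) * (inverse q ^ v * inverse (1 - q ^ (n - v)))"
  have qn: "q ^ n = q ^ v * q ^ (n - v)" using v by (simp flip: power_add)
  have y: "unipot y r"
  proof -
    have "inverse y = 1 + e * (- r)" "y \<noteq> 0"
      using nz qn by (simp_all add: y_def r_def e_def field_simps)
    moreover from this have "unipot (inverse y) (- r)"
      using r by (auto simp: unipot_def)
    moreover have "y \<in> R" unfolding y_def using r by auto
    ultimately show ?thesis
      using unipot_inverse[of "inverse y" "- r"] by (metis inverse_inverse_eq inverse_zero_imp_zero minus_minus)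
  qed
  define X where "X = q powi (int n * (- h)) * y * x'"
  define Y where "Y = q powi (int n * a) * x"
  have "res (n - v) = res v * (q powi (int n * (- h)) * y)"
    unfolding res_def tri_reflect[OF v(2) h] neg_one_reflect[OF odd v(2)] y_def
  proof -
    have "q powi (- (int n * h + tri v + int v)) = q powi (- tri v) * q powi (int n * (- h)) * inverse q ^ v"
      by (simp add: power_int_diff power_int_minus power_int_add divide_inverse power_inverse)
    moreover have "- s * (P * Z * I) / d' = s * P / d * (Z * (- d * (I * inverse d')))"
      if "d \<noteq> 0" for s P Z I d d' :: 'a
      using that by (simp add: divide_inverse)
    ultimately show "- ((- 1) ^ v) * q powi (- (int n * h + tri v + int v)) / (1 - q ^ (n - v))
        = (- 1) ^ v * q powi (- tri v) / (1 - q ^ v)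
          * (q powi (int n * (- h)) * (- (1 - q ^ v) * (inverse q ^ v * inverse (1 - q ^ (n - v)))))"
      using nz(1) by metis
  qed
  then have X: "q ^ expo1 i * D (n - v) = - (1 - q ^ (2 * n)) * c * X"
    unfolding x'(1) c_def X_def by simp
  have "q ^ expo2 (l - Suc i) = q powi int (expo2 (l - Suc i))" by simp
  also have "\<dots> = q ^ expo1 i * q powi (int n * a)"
    unfolding expo_reflect[OF i] a_def n3 by (simp add: power_int_add)
  finally have Y: "q ^ expo2 (l - Suc i) * D v = - (1 - q ^ (2 * n)) * c * Y"
    unfolding x(1) c_def Y_def by simp
  have uY: "unipot Y (- of_int a + - 2 * harm_q (v - 1))"
    unfolding Y_def by (intro unipot_mult unipot_powi x)
  have uX: "unipot X (- of_int (- h) + r + - 2 * harm_q (n - v - 1))"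
    unfolding X_def by (intro unipot_mult unipot_powi y x')
  have uX': "unipot X (- of_int a + - 2 * harm_q (v - 1) - g)"
  proof (rule unipot_cong[OF uX])
    have "- of_int (- h) + r + - 2 * harm_q (n - v - 1) = of_int h + r - 2 * harm_q (n - Suc v)"
      by simp
    \<comment> \<open>After reflection the harmonic sum in \<open>X\<close> becomes the one in
      \<open>Y\<close>, up to \<open>r\<close> and integers.\<close>
    also have "eqm 1 \<dots> (of_int h + r - (of_nat (n - 1) + 2 * harm_q v - 2 * of_nat v))"
      by (intro eqm_diff eqm_refl harm_q_reflect v)
    also have "\<dots> = - of_int a + - 2 * harm_q (v - 1) - g"
    proof -
      have hv: "harm_q v = harm_q (v - 1) + r"
        using harm_q_Suc[of "v - 1"] v by (simp add: r_def)
      have "odd l" using odd n3 by simp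
      \<comment> \<open>The constant \<open>(l + 1) / 2\<close> of \<open>R(a, q)\<close> originates
        here, from the exponents \<open>h\<close> and \<open>a\<close> and the count in
        \<open>harm_q_reflect\<close>; odd \<open>l\<close> makes the halves integral.\<close>
      then have "h + a = int (n - 1) - 2 * int v - (int i - (int l + 1) div 2)"
        using h i by (auto simp: a_def n3 v_def of_nat_diff elim!: oddE)
      then have "of_int (h + a) = (of_int (int (n - 1) - 2 * int v - (int i - (int l + 1) div 2)) :: 'a)"
        by (rule arg_cong)
      then have "of_int h = (of_nat (n - 1) - 2 * of_nat v - of_int (int i - (int l + 1) div 2) - of_int a :: 'a)"
        unfolding eq_diff_eq by (simp del: of_nat_diff)
      then show ?thesis unfolding hv g_def by (simp add: ring_distribs)
    qed
    finally show "eqm 1 (- of_int (- h) + r + - 2 * harm_q (n - v - 1))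
        (- of_int a + - 2 * harm_q (v - 1) - g)" .
    show "- of_int a + - 2 * harm_q (v - 1) - g \<in> R"
      using unipot_closed(2)[OF uY] g by simp
  qed
  have XY: "eqm 2 (X - Y) (e * (- g))"
    using unipot_diff[OF uX' uY] by simp
  have q2n: "1 - q ^ (2 * n) = e * (2 - e)"
    unfolding e_def mult_2 power_add by (simp add: algebra_simps)
  have "eqm 1 (- (1 - q ^ (2 * n)) * c) 0"
  proof -
    have *: "- (e * (2 - e)) * c = e * (- (2 - e) * c)" by (simp add: algebra_simps)
    show ?thesis unfolding q2n * using c two by (intro eqm_e_zero) auto
  qed
  from eqm_scale_zero[OF this XY]
  have "eqm 3 (q ^ expo1 i * D (n - v) - q ^ expo2 (l - Suc i) * D v)
      (- (1 - q ^ (2 * n)) * c * (e * (- g)))"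
    unfolding X Y by (simp add: right_diff_distrib numeral_3_eq_3)
  \<comment> \<open>Replacing \<open>2 - e\<close> by 2 costs
    \<open>- (e ^ 3 * c * g)\<close>.\<close>
  also have "eqm 3 \<dots> (2 * e\<^sup>2 * (c * g))"
    unfolding q2n
    by (rule eqmI[of "- (c * g)"]) (use c g in \<open>auto simp: algebra_simps power2_eq_square power3_eq_cube\<close>)
  finally show ?thesis unfolding c_def g_def r_def .
qed

theorem alternating_sum_eqm_3:
  assumes D0: "D 0 = 1"
    and rec: "\<And>v. v < n \<Longrightarrow> (1 - q ^ Suc v) * D (Suc v) = (1 - q ^ (2 * n - v)) * D v"
    and n3: "n = 3 * l" and odd: "odd n"
  shows "eqm 3 (\<Sum>i<l. q ^ expo1 i * D (n - (3 * i + 1)) - q ^ expo2 i * D (n - (3 * i + 2)))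
    (2 * e\<^sup>2 * (\<Sum>i<l. q ^ expo1 i * res (3 * i + 1) *
       (inverse (1 - q ^ (3 * i + 1)) + of_int (int i - (int l + 1) div 2))))"
proof -
  let ?f = "\<lambda>i. q ^ expo1 i * D (n - (3 * i + 1))"
  let ?g = "\<lambda>i. q ^ expo2 i * D (n - (3 * i + 2))"
  let ?h = "\<lambda>i. q ^ expo1 i * res (3 * i + 1) *
       (inverse (1 - q ^ (3 * i + 1)) + of_int (int i - (int l + 1) div 2))"
  have 1: "(\<Sum>i<l. ?f i - ?g i) = (\<Sum>i<l. ?f i - ?g (l - Suc i))"
    unfolding sum_subtractf sum.nat_diff_reindex[of ?g l] ..
  have 2: "eqm 3 (\<Sum>i<l. ?f i - ?g (l - Suc i)) (\<Sum>i<l. 2 * e\<^sup>2 * ?h i)"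
  proof (rule eqm_sum)
    fix i assume "i \<in> {..<l}"
    then have i: "i < l" and eq: "n - (3 * (l - Suc i) + 2) = 3 * i + 1"
      by (auto simp: n3)
    show "eqm 3 (?f i - ?g (l - Suc i)) (2 * e\<^sup>2 * ?h i)"
      unfolding eq by (rule pair_eqm_3[of D l i, OF D0 rec n3 odd i refl])
  qed
  show ?thesis
    unfolding 1 using 2 by (simp only: sum_distrib_left)
qed

text \<open>For \<open>k = 3 * i + 1\<close> the exponent is \<open>(k + 2) * (k - 1) / 6\<close>,
  as in \<open>Rfun\<close>.\<close>

lemma expo1_res:
  "q ^ expo1 i * res (3 * i + 1) = (- 1) ^ (3 * i + 1) * q ^ (3 * i * (i + 1) div 2) / (1 - q ^ (3 * i + 1))"
proof -
  have "2 * (int (expo1 i) - tri (3 * i + 1)) = 3 * int i * (int i + 1)"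
    unfolding right_diff_distrib tri_double by (simp add: expo1_def algebra_simps)
  moreover have "int (3 * i * (i + 1) div 2) = 3 * int i * (int i + 1) div 2"
    by (simp add: zdiv_int algebra_simps)
  ultimately have "int (expo1 i) - tri (3 * i + 1) = int (3 * i * (i + 1) div 2)"
    by (metis nonzero_mult_div_cancel_left zero_neq_numeral)
  then have "q ^ (3 * i * (i + 1) div 2) = q powi (int (expo1 i) - tri (3 * i + 1))"
    by simp
  then show ?thesis by (simp add: res_def power_int_diff power_int_minus divide_inverse)
qed

end

section \<open>The localization at a cyclotomic polynomial\<close>

lemma tf_0 [simp]: "tf 0 = 0" and tf_1 [simp]: "tf 1 = 1"
  by (simp_all add: tf_def Zero_fract_def One_fract_def)

lemma tf_add: "tf (p + r) = tf p + tf r"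
  and tf_diff: "tf (p - r) = tf p - tf r"
  and tf_mult: "tf (p * r) = tf p * tf r"
  by (simp_all add: tf_def)

lemma tf_eq_iff [simp]: "tf p = tf r \<longleftrightarrow> p = r"
  by (simp add: tf_def eq_fract)

lemma tf_eq_0_iff [simp]: "tf p = 0 \<longleftrightarrow> p = 0"
  using tf_eq_iff[of p 0] by simp

lemma tf_power: "tf (p ^ k) = tf p ^ k"
  by (induction k) (simp_all add: tf_mult)

lemma tf_sum: "tf (sum f A) = (\<Sum>i\<in>A. tf (f i))"
  by (induction A rule: infinite_finite_induct) (simp_all add: tf_add)

lemma tf_const_of_int: "tf [:of_int z:] = of_int z"
proof -
  have nat: "tf [:of_nat k:] = of_nat k" for k
  proof (induction k)
    case (Suc k)
    have "[:of_nat (Suc k):] = [:of_nat k:] + (1 :: rat poly)" by (simp add: one_pCons)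
    then show ?case using Suc by (simp only: tf_add tf_1 of_nat_Suc add.commute)
  qed simp
  show ?thesis
  proof (cases z rule: int_cases2)
    case (nonneg k)
    then show ?thesis using nat by simp
  next
    case (nonpos k)
    have "tf [:of_int z:] = tf (0 - [:of_nat k:])" by (simp add: nonpos)
    also have "\<dots> = of_int z" by (simp only: tf_diff nat) (simp add: nonpos)
    finally show ?thesis .
  qed
qed

lemma Fract_eq_tf: "d \<noteq> 0 \<Longrightarrow> Fract c d = tf c / tf d"
  by (simp add: tf_def divide_fract)

definition localization :: "rat poly \<Rightarrow> rat poly fract set" where
  "localization M = {tf c / tf d | c d. d \<noteq> 0 \<and> coprime d M}"

lemma localizationI: "d \<noteq> 0 \<Longrightarrow> coprime d M \<Longrightarrow> tf c / tf d \<in> localization M"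
  unfolding localization_def by blast

lemma tf_in_localization [simp]: "tf c \<in> localization M"
  using localizationI[of 1 M c] by simp

lemma inverse_tf_in_localization: "d \<noteq> 0 \<Longrightarrow> coprime d M \<Longrightarrow> inverse (tf d) \<in> localization M"
  using localizationI[of d M 1] by (simp add: divide_inverse)

lemma localization_diff_mult:
  assumes "x \<in> localization M" "y \<in> localization M"
  shows "x - y \<in> localization M" "x * y \<in> localization M"
proof -
  obtain c d c' d' where x: "x = tf c / tf d" "d \<noteq> 0" "coprime d M"
    and y: "y = tf c' / tf d'" "d' \<noteq> 0" "coprime d' M"
    using assms unfolding localization_def by blast
  have "x - y = tf (c * d' - c' * d) / tf (d * d')" "x * y = tf (c * c') / tf (d * d')"
    unfolding x(1) y(1) using x(2) y(2) by (simp_all add: tf_mult tf_diff field_simps)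
  moreover have "d * d' \<noteq> 0" "coprime (d * d') M"
    using x y by simp_all
  ultimately show "x - y \<in> localization M" "x * y \<in> localization M"
    by (simp_all add: localizationI)
qed

lemma qcongI:
  assumes "z \<in> localization M" "A - B = tf M * z"
  shows "qcong A B M"
proof -
  obtain c d where d: "d \<noteq> 0" "coprime d M" and "z = Fract c d"
    using assms(1) Fract_eq_tf unfolding localization_def by force
  with assms(2) show ?thesis unfolding qcong_def by blast
qed

lemma dvd_of_localization:
  assumes "z \<in> localization M" "tf S = tf (M ^ k) * z"
  shows "M ^ k dvd S"
proof -
  obtain c d where z: "z = tf c / tf d" "d \<noteq> 0" "coprime d M"
    using assms unfolding localization_def by blast
  have "tf (S * d) = tf (M ^ k * c)"
    using assms(2) z by (simp add: tf_mult)
  then have "M ^ k dvd S * d" by simp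
  moreover have "coprime M d" using z(3) by (simp only: coprime_commute)
  then have "coprime (M ^ k) d" by simp
  ultimately show ?thesis by (simp add: coprime_dvd_mult_left_iff)
qed

text \<open>With \<open>x = qpoly ^ 3 ^ (a - 1)\<close>, \<open>Phi3 a\<close> is
  \<open>1 + x + x\<^sup>2\<close>. The second form shows that it is the constant 3 modulo
  \<open>1 - x\<close>, hence a unit there over the rationals.\<close>

lemma one_minus_power_eq_Phi3:
  assumes "a > 0"
  shows "1 - qpoly ^ 3 ^ a = Phi3 a * (1 - qpoly ^ 3 ^ (a - 1))"
    and "Phi3 a = 3 - (1 - qpoly ^ 3 ^ (a - 1)) * (qpoly ^ 3 ^ (a - 1) + 2)"
proof -
  define x where "x = qpoly ^ 3 ^ (a - 1)"
  have "(3::nat) ^ a = 3 ^ (a - 1) * 3" using assms by (cases a) auto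
  then have x3: "qpoly ^ 3 ^ a = x ^ 3" by (simp add: x_def power_mult)
  have "x - 1 \<noteq> 0" using qpoly_power_neq_1[of "3 ^ (a - 1)"] by (simp add: x_def)
  moreover have "x ^ 3 - 1 = (1 + x + x\<^sup>2) * (x - 1)"
    by (simp add: algebra_simps power2_eq_square power3_eq_cube)
  ultimately have Phi: "Phi3 a = 1 + x + x\<^sup>2"
    unfolding Phi3_def x3 x_def[symmetric] by simp
  show "1 - qpoly ^ 3 ^ a = Phi3 a * (1 - qpoly ^ 3 ^ (a - 1))"
    unfolding x3 Phi x_def[symmetric] by (simp add: algebra_simps power2_eq_square power3_eq_cube)
  show "Phi3 a = 3 - (1 - qpoly ^ 3 ^ (a - 1)) * (qpoly ^ 3 ^ (a - 1) + 2)"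
    unfolding Phi x_def[symmetric] by (simp add: algebra_simps power2_eq_square)
qed

lemma one_minus_power_dvd: "x dvd y \<Longrightarrow> 1 - (p :: 'a :: comm_ring_1) ^ x dvd 1 - p ^ y"
proof -
  assume "x dvd y"
  then obtain k where "y = x * k" ..
  then have "1 - p ^ y = (1 - p ^ x) * (\<Sum>i<k. (p ^ x) ^ i)"
    by (simp add: power_mult one_diff_power_eq)
  then show ?thesis by simp
qed

text \<open>Bezout in the exponents, written as \<open>x * u = y * v + gcd x y\<close> to stay
  within the naturals.\<close>

lemma dvd_one_minus_power_gcd:
  fixes p g :: "'a :: comm_ring_1"
  assumes "g dvd 1 - p ^ x" "g dvd 1 - p ^ y" "x > 0"
  shows "g dvd 1 - p ^ gcd x y"
proof -
  obtain u v where uv: "x * u = y * v + gcd x y"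
    using bezout_nat[of x y] assms(3) by auto
  let ?d = "gcd x y"
  have "g dvd 1 - p ^ (x * u)" "g dvd 1 - p ^ (y * v)"
    by (rule dvd_trans[OF assms(1)] dvd_trans[OF assms(2)], rule one_minus_power_dvd, simp)+
  moreover have "1 - p ^ ?d = (1 - p ^ (x * u)) - (1 - p ^ (y * v)) * p ^ ?d"
    unfolding uv by (simp add: algebra_simps power_add)
  ultimately show ?thesis by (simp only: dvd_diff dvd_mult2)
qed

text \<open>The gcd of \<open>w\<close> and \<open>3 ^ a\<close> is a proper divisor of
  \<open>3 ^ a\<close>, so it divides \<open>3 ^ (a - 1)\<close>. A common divisor therefore divides
  \<open>1 - qpoly ^ 3 ^ (a - 1)\<close>, and then 3.\<close>

lemma coprime_one_minus_power_Phi3: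
  assumes "a > 0" "\<not> 3 ^ a dvd w"
  shows "coprime (1 - qpoly ^ w) (Phi3 a)"
proof (rule coprimeI)
  fix g assume g: "g dvd 1 - qpoly ^ w" "g dvd Phi3 a"
  have "w > 0" using assms(2) by (cases "w = 0") auto
  then have "g dvd 1 - qpoly ^ gcd w (3 ^ a)"
    using g one_minus_power_eq_Phi3(1)[OF assms(1)] by (intro dvd_one_minus_power_gcd) auto
  moreover have "gcd w (3 ^ a) dvd 3 ^ (a - 1)"
  proof -
    have "prime (3 :: nat)" by simp
    then obtain b where b: "b \<le> a" "gcd w (3 ^ a) = 3 ^ b"
      by (meson divides_primepow_nat gcd_dvd2)
    have "b \<noteq> a" using b assms(2) by (metis gcd_dvd1)
    then show ?thesis unfolding b(2) using b(1) by (intro le_imp_power_dvd) simp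
  qed
  ultimately have "g dvd 1 - qpoly ^ 3 ^ (a - 1)"
    by (metis one_minus_power_dvd dvd_trans)
  then have "g dvd Phi3 a + (1 - qpoly ^ 3 ^ (a - 1)) * (qpoly ^ 3 ^ (a - 1) + 2)"
    using g(2) by simp
  then have "g dvd 3" unfolding one_minus_power_eq_Phi3(2)[OF assms(1)] by simp
  moreover have "(3 :: rat poly) dvd 1"
    by (rule dvdI[of _ _ "[:1 / 3:]"]) (simp add: numeral_poly one_pCons)
  ultimately show "is_unit g" by (rule dvd_trans)
qed

lemma coprime_qpoly_Phi3:
  assumes "a > 0"
  shows "coprime qpoly (Phi3 a)"
proof (rule coprimeI)
  fix g assume g: "g dvd qpoly" "g dvd Phi3 a"
  then have "g dvd 1 - qpoly ^ 3 ^ a"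
    using one_minus_power_eq_Phi3(1)[OF assms] by simp
  moreover have "g dvd qpoly ^ 3 ^ a" using g(1) by (simp add: dvd_power dvd_trans)
  ultimately show "is_unit g" by (metis diff_add_cancel dvd_add)
qed

lemma qpoly_nonzero: "qpoly \<noteq> 0"
  by (simp add: qpoly_def)

lemma root_of_unity_expansion_Phi3:
  assumes "a > 0"
  shows "root_of_unity_expansion (localization (Phi3 a)) (1 - tf qpoly ^ 3 ^ a) (tf qpoly) (3 ^ a)"
proof
  have tf_cyclo: "1 - tf qpoly ^ w = tf (1 - qpoly ^ w)" for w
    by (simp add: tf_diff tf_power)
  show "1 \<in> localization (Phi3 a)" using tf_in_localization[of 1] by simp
  show "1 - tf qpoly ^ 3 ^ a \<in> localization (Phi3 a)" unfolding tf_cyclo by simp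
  show "(1 :: nat) < 3 ^ a" using assms by (intro one_less_power) simp_all
  show "inverse (tf qpoly) \<in> localization (Phi3 a)"
    by (intro inverse_tf_in_localization coprime_qpoly_Phi3 assms qpoly_nonzero)
  fix w :: nat assume w: "\<not> 3 ^ a dvd w"
  then have "w > 0" by (cases "w = 0") auto
  then have nz: "1 - qpoly ^ w \<noteq> 0" using qpoly_power_neq_1[of w] by simp
  then show "1 - tf qpoly ^ w \<noteq> 0" unfolding tf_cyclo by simp
  show "inverse (1 - tf qpoly ^ w) \<in> localization (Phi3 a)"
    unfolding tf_cyclo by (intro inverse_tf_in_localization nz coprime_one_minus_power_Phi3 assms w)
qed (simp_all add: localization_diff_mult qpoly_nonzero)

section \<open>Divisibility and the quotient modulo the cyclotomic polynomial\<close>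

lemma three_power_pred: "a > 0 \<Longrightarrow> (3::nat) ^ a = 3 * 3 ^ (a - 1)"
  by (cases a) auto

lemma tf_one_minus_power: "tf (1 - qpoly ^ k) = 1 - tf qpoly ^ k"
  by (simp add: tf_diff tf_power)

lemma Phi3_squared_dvd_Ssum:
  assumes "a > 0"
  shows "(Phi3 a)\<^sup>2 dvd Ssum (3 ^ a * m)"
proof -
  interpret root_of_unity_expansion "localization (Phi3 a)" "1 - tf qpoly ^ 3 ^ a" "tf qpoly" "3 ^ a"
    by (rule root_of_unity_expansion_Phi3[OF assms])
  let ?N = "3 ^ a * m" and ?l = "3 ^ (a - 1) :: nat"
  \<comment> \<open>The cutoff \<open>?l * m\<close> gives exactly \<open>m\<close> full blocks, as
    \<open>3 * (?l * m) = ?N\<close>.\<close>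
  have "Ssum ?N = (\<Sum>i<?l * m. qalt ?N i)"
    by (rule Ssum_eq) (simp add: three_power_pred[OF assms])
  then have S: "tf (Ssum ?N) = (\<Sum>i<?l * m. tf qpoly ^ expo1 i * tf (qcentral ?N (3 * i + 1))
      - tf qpoly ^ expo2 i * tf (qcentral ?N (3 * i + 2)))"
    by (simp only: tf_sum tf_diff tf_mult tf_power expo1_def expo2_def)
  have "eqm 2 (tf (Ssum ?N)) 0"
    unfolding S
  proof (rule alternating_sum_eqm_2)
    fix j
    have "2 * ?N - (?N + j) = ?N - j" by (simp only: mult_2 diff_diff_left[symmetric] diff_add_inverse)
    then show "(1 - tf qpoly ^ (?N + j + 1)) * tf (qcentral ?N (j + 1))
        = (1 - tf qpoly ^ (?N - j)) * tf (qcentral ?N j)"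
      using qbinom_absorb'[of "?N + j" "2 * ?N"]
      unfolding tf_one_minus_power[symmetric] tf_mult[symmetric] by simp
  qed (use three_power_pred[OF assms] in auto)
  then obtain z where z: "z \<in> localization (Phi3 a)" "tf (Ssum ?N) = (1 - tf qpoly ^ 3 ^ a)\<^sup>2 * z"
    by (auto simp: eqm_def)
  have "(1 - tf qpoly ^ 3 ^ a)\<^sup>2 * z = tf ((Phi3 a)\<^sup>2) * (tf ((1 - qpoly ^ ?l)\<^sup>2) * z)"
    unfolding tf_one_minus_power[symmetric] one_minus_power_eq_Phi3(1)[OF assms]
    by (simp add: tf_mult tf_power power_mult_distrib)
  then show ?thesis
    using z by (intro dvd_of_localization[of "tf ((1 - qpoly ^ ?l)\<^sup>2) * z"]) auto
qed

lemma qint_three_power_Suc: "qint (3 ^ Suc a) = qint (3 ^ a) * Phi3 (Suc a)"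
proof -
  have "(1 - qpoly) * qint (3 ^ Suc a) = (1 - qpoly) * (qint (3 ^ a) * Phi3 (Suc a))"
    unfolding mult.assoc[symmetric] qint_mult one_minus_power_eq_Phi3(1)[OF zero_less_Suc]
    by simp
  moreover have "1 - qpoly \<noteq> 0" using qpoly_power_neq_1[of 1] by simp
  ultimately show ?thesis by simp
qed

text \<open>\<open>m\<close> varies in the induction: \<open>3 ^ Suc a * m\<close> is
  \<open>3 ^ a * (3 * m)\<close>. The new factor \<open>Phi3 (Suc a)\<close> is coprime to
  \<open>qint (3 ^ a)\<close>, a divisor of \<open>1 - qpoly ^ 3 ^ a\<close>.\<close>

lemma qint_squared_dvd_Ssum: "(qint (3 ^ a))\<^sup>2 dvd Ssum (3 ^ a * m)"
proof (induction a arbitrary: m)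
  case 0
  then show ?case by (simp add: qint_def)
next
  case (Suc a)
  have "coprime (1 - qpoly ^ 3 ^ a) (Phi3 (Suc a))"
    by (rule coprime_one_minus_power_Phi3) (auto dest: dvd_imp_le)
  then have "coprime (qint (3 ^ a)) (Phi3 (Suc a))"
    unfolding qint_mult[symmetric] by simp
  then have "coprime ((qint (3 ^ a))\<^sup>2) ((Phi3 (Suc a))\<^sup>2)" by simp
  moreover have "(qint (3 ^ a))\<^sup>2 dvd Ssum (3 ^ Suc a * m)"
    using Suc.IH[of "3 * m"] by (simp add: ac_simps)
  ultimately show ?case
    unfolding qint_three_power_Suc power_mult_distrib
    by (intro divides_mult Phi3_squared_dvd_Ssum) auto
qed

section \<open>The sum R(a, q) and the congruence (ii)\<close>

lemma Rfun_eq: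
  assumes "a > 0"
  shows "Rfun a = (1 - tf qpoly)\<^sup>2 * (\<Sum>i<3 ^ (a - 1).
    (- 1) ^ (3 * i + 1) * tf qpoly ^ (3 * i * (i + 1) div 2) / (1 - tf qpoly ^ (3 * i + 1))
      * (inverse (1 - tf qpoly ^ (3 * i + 1)) + of_int (int i - (int (3 ^ (a - 1)) + 1) div 2)))"
proof -
  let ?l = "3 ^ (a - 1) :: nat" and ?q = "tf qpoly"
  let ?t = "\<lambda>k. tf (qpoly ^ ((k + 2) * (k - 1) div 6)) * (-1) ^ k / (tf (qint k)) ^ 2 *
      (1 + tf [: of_nat (k - 1) / 3 - (3 ^ (a - 1) + 1) / 2 :] * tf (1 - qpoly ^ k))"
  have "{k. 1 \<le> k \<and> k \<le> 3 ^ a - 1 \<and> k mod 3 = 1} = (\<lambda>i. 3 * i + 1) ` {..<?l}"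
  proof (intro set_eqI iffI)
    fix k assume "k \<in> {k. 1 \<le> k \<and> k \<le> 3 ^ a - 1 \<and> k mod 3 = (1 :: nat)}"
    then have "k mod 3 = 1" "k < ?l * 3"
      using three_power_pred[OF assms] by auto
    then have "k = 3 * (k div 3) + 1" "k div 3 < ?l"
      using div_mult_mod_eq[of k 3] less_mult_imp_div_less by (simp_all add: mult.commute)
    then show "k \<in> (\<lambda>i. 3 * i + 1) ` {..<?l}" by blast
  qed (use three_power_pred[OF assms] in auto)
  then have "Rfun a = (\<Sum>i<?l. ?t (3 * i + 1))"
    unfolding Rfun_def by (simp add: sum.reindex inj_on_def)
  also have "\<dots> = (\<Sum>i<?l. (1 - ?q)\<^sup>2 * ((- 1) ^ (3 * i + 1) * ?q ^ (3 * i * (i + 1) div 2) / (1 - ?q ^ (3 * i + 1))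
      * (inverse (1 - ?q ^ (3 * i + 1)) + of_int (int i - (int ?l + 1) div 2))))"
  proof (rule sum.cong[OF refl])
    fix i :: nat
    define k where "k = 3 * i + 1"
    define z where "z = int i - (int ?l + 1) div 2"
    \<comment> \<open>Oddness of \<open>?l\<close> makes the rational constant in
      \<open>Rfun\<close> an integer.\<close>
    have "odd ?l" by simp
    then obtain p where p: "?l = 2 * p + 1" by (rule oddE)
    have "(3 :: rat) ^ (a - 1) = 2 * of_nat p + 1"
      using arg_cong[OF p, of "of_nat :: nat \<Rightarrow> rat"] by simp
    moreover have "(int ?l + 1) div 2 = int p + 1" unfolding p by simp
    ultimately have "(3 ^ (a - 1) + 1 :: rat) / 2 = of_int ((int ?l + 1) div 2)"
      by (simp add: field_simps)
    then have const: "of_nat (k - 1) / 3 - (3 ^ (a - 1) + 1) / 2 = (of_int z :: rat)"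
      by (simp add: k_def z_def)
    have "(k + 2) * (k - 1) = 3 * (3 * i * (i + 1))" by (simp add: k_def algebra_simps)
    then have expo: "(k + 2) * (k - 1) div 6 = 3 * i * (i + 1) div 2"
      using div_mult_mult1[of 3 "3 * i * (i + 1)" 2] by simp
    \<comment> \<open>Here \<open>d\<close> is \<open>1 - ?q ^ k\<close> and \<open>u\<close> is
      \<open>1 - ?q\<close>, so that \<open>d / u\<close> is the q-integer.\<close>
    have regroup: "P * s / (d / u)\<^sup>2 * (1 + c * d) = u\<^sup>2 * (s * P / d * (inverse d + c))"
      if "d \<noteq> 0" "u \<noteq> 0" for P s d u c :: "rat poly fract"
      using that by (simp add: field_simps power2_eq_square)
    have "tf (1 - qpoly ^ k) \<noteq> 0" "tf (1 - qpoly ^ 1) \<noteq> 0"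
      using qpoly_power_neq_1[of k] qpoly_power_neq_1[of 1] by (simp_all add: k_def)
    then have "1 - ?q ^ k \<noteq> 0" "1 - ?q \<noteq> 0"
      unfolding tf_one_minus_power by simp_all
    moreover have "tf (qint k) = (1 - ?q ^ k) / (1 - ?q)"
      using arg_cong[OF qint_mult[of k], of tf] calculation
      by (simp add: tf_mult tf_diff tf_power field_simps)
    ultimately have "?t k = (1 - ?q)\<^sup>2 * ((- 1) ^ k * ?q ^ (3 * i * (i + 1) div 2) / (1 - ?q ^ k)
      * (inverse (1 - ?q ^ k) + of_int z))"
      unfolding const expo tf_const_of_int tf_one_minus_power tf_power
      by (simp only:) (rule regroup)
    then show "?t (3 * i + 1) = (1 - ?q)\<^sup>2 * ((- 1) ^ (3 * i + 1) * ?q ^ (3 * i * (i + 1) div 2) / (1 - ?q ^ (3 * i + 1))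
      * (inverse (1 - ?q ^ (3 * i + 1)) + of_int (int i - (int ?l + 1) div 2)))"
      unfolding k_def z_def .
  qed
  finally show ?thesis unfolding sum_distrib_left[symmetric] .
qed

text \<open>As \<open>?e = (1 - ?q) * tf (qint ?n)\<close>, the main term
  \<open>2 * ?e\<^sup>2 * H\<close> is the squared q-integer times \<open>2 * Rfun a\<close>.
  Dividing the error \<open>?e ^ 3 * z\<close> by that square leaves one factor \<open>?e\<close>, a
  multiple of \<open>Phi3 a\<close>.\<close>

lemma qcong_Ssum_Rfun:
  assumes "a > 0"
  shows "qcong (tf (Ssum (3 ^ a) div (qint (3 ^ a))\<^sup>2)) (2 * Rfun a) (Phi3 a)"
proof -
  interpret root_of_unity_expansion "localization (Phi3 a)" "1 - tf qpoly ^ 3 ^ a" "tf qpoly" "3 ^ a"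
    by (rule root_of_unity_expansion_Phi3[OF assms])
  let ?n = "3 ^ a :: nat" and ?l = "3 ^ (a - 1) :: nat" and ?q = "tf qpoly"
  let ?e = "1 - ?q ^ ?n"
  \<comment> \<open>The row is indexed from its upper end: \<open>D 0 = 1\<close>, absorption read
    downwards is the required recurrence, and \<open>D (?n - j)\<close> is
    \<open>qcentral ?n j\<close> for \<open>j \<le> ?n\<close>.\<close>
  define D where "D v = tf (qbinom (2 * ?n) (2 * ?n - v))" for v
  note n3 = three_power_pred[OF assms]
  have "Ssum ?n = (\<Sum>i<?l. qalt ?n i)"
    by (rule Ssum_eq) (simp add: n3)
  then have S: "tf (Ssum ?n) = (\<Sum>i<?l. ?q ^ expo1 i * tf (qcentral ?n (3 * i + 1))
      - ?q ^ expo2 i * tf (qcentral ?n (3 * i + 2)))"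
    by (simp only: tf_sum tf_diff tf_mult tf_power expo1_def expo2_def)
  also have "\<dots> = (\<Sum>i<?l. ?q ^ expo1 i * D (?n - (3 * i + 1)) - ?q ^ expo2 i * D (?n - (3 * i + 2)))"
  proof (rule sum.cong[OF refl])
    fix i assume "i \<in> {..<?l}"
    then have "2 * ?n - (?n - (3 * i + 1)) = ?n + (3 * i + 1)" "2 * ?n - (?n - (3 * i + 2)) = ?n + (3 * i + 2)"
      by (auto simp: n3)
    then show "?q ^ expo1 i * tf (qcentral ?n (3 * i + 1)) - ?q ^ expo2 i * tf (qcentral ?n (3 * i + 2))
        = ?q ^ expo1 i * D (?n - (3 * i + 1)) - ?q ^ expo2 i * D (?n - (3 * i + 2))"
      by (simp only: D_def)
  qed
  finally have S': "tf (Ssum ?n)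
      = (\<Sum>i<?l. ?q ^ expo1 i * D (?n - (3 * i + 1)) - ?q ^ expo2 i * D (?n - (3 * i + 2)))" .
  define H where "H = (\<Sum>i<?l. (- 1) ^ (3 * i + 1) * ?q ^ (3 * i * (i + 1) div 2) / (1 - ?q ^ (3 * i + 1))
      * (inverse (1 - ?q ^ (3 * i + 1)) + of_int (int i - (int ?l + 1) div 2)))"
  have "eqm 3 (tf (Ssum ?n)) (2 * ?e\<^sup>2 * H)"
    unfolding S' H_def expo1_res[symmetric]
  proof (rule alternating_sum_eqm_3[OF _ _ n3])
    show "D 0 = 1" by (simp add: D_def qbinom_self)
    fix v assume "v < ?n"
    then have "Suc (2 * ?n - Suc v) = 2 * ?n - v" "2 * ?n - (2 * ?n - Suc v) = Suc v" by auto
    then show "(1 - ?q ^ Suc v) * D (Suc v) = (1 - ?q ^ (2 * ?n - v)) * D v"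
      using qbinom_absorb'[of "2 * ?n - Suc v" "2 * ?n"]
      unfolding D_def tf_one_minus_power[symmetric] tf_mult[symmetric] by simp
  qed simp
  then obtain z where z: "z \<in> localization (Phi3 a)" "tf (Ssum ?n) - 2 * ?e\<^sup>2 * H = ?e ^ 3 * z"
    unfolding eqm_def by blast
  have R: "Rfun a = (1 - ?q)\<^sup>2 * H"
    unfolding Rfun_eq[OF assms] H_def ..
  have e: "?e = (1 - ?q) * tf (qint ?n)"
    using arg_cong[OF qint_mult[of ?n], of tf] by (simp add: tf_mult tf_diff tf_power)
  have nz: "tf (qint ?n) \<noteq> 0" using qint_nonzero[of ?n] by simp
  have "Ssum ?n = (Ssum ?n div (qint ?n)\<^sup>2) * (qint ?n)\<^sup>2"
    using qint_squared_dvd_Ssum[of a 1] by simp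
  then have "tf (Ssum ?n) = tf (Ssum ?n div (qint ?n)\<^sup>2) * (tf (qint ?n))\<^sup>2"
    by (metis tf_mult tf_power)
  then have "(tf (qint ?n))\<^sup>2 * (tf (Ssum ?n div (qint ?n)\<^sup>2) - 2 * Rfun a) = tf (Ssum ?n) - 2 * ?e\<^sup>2 * H"
    unfolding R e power_mult_distrib by (simp add: algebra_simps)
  also have "\<dots> = (tf (qint ?n))\<^sup>2 * ((1 - ?q)\<^sup>2 * ?e * z)"
  proof -
    have "x ^ 3 * z = v\<^sup>2 * (u\<^sup>2 * x * z)" if "x = u * v" for x u v :: "rat poly fract"
      using that by (simp add: power2_eq_square power3_eq_cube mult_ac)
    from this[OF e] show ?thesis unfolding z(2) .
  qed
  finally have "tf (Ssum ?n div (qint ?n)\<^sup>2) - 2 * Rfun a = (1 - ?q)\<^sup>2 * ?e * z"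
    using nz by simp
  also have "?e = tf (Phi3 a) * tf (1 - qpoly ^ ?l)"
    unfolding tf_one_minus_power[symmetric, of ?n] one_minus_power_eq_Phi3(1)[OF assms] tf_mult ..
  finally have "tf (Ssum ?n div (qint ?n)\<^sup>2) - 2 * Rfun a
      = tf (Phi3 a) * ((1 - ?q)\<^sup>2 * tf (1 - qpoly ^ ?l) * z)"
    by (simp add: mult_ac)
  moreover have "(1 - ?q)\<^sup>2 * tf (1 - qpoly ^ ?l) * z \<in> localization (Phi3 a)"
    using z by (intro mult_closed power_closed diff_closed) auto
  ultimately show ?thesis by (rule qcongI[rotated])
qed

theorem theorem1p3:
  fixes a :: nat
  assumes "a > 0"
  shows "(\<forall>m::nat. m > 0 \<longrightarrow> (qint (3 ^ a)) ^ 2 dvd Ssum (3 ^ a * m))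
       \<and> qcong (tf (Ssum (3 ^ a) div (qint (3 ^ a)) ^ 2)) (2 * Rfun a) (Phi3 a)"
  using qint_squared_dvd_Ssum qcong_Ssum_Rfun[OF assms] by blast

end
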